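(* Let $q_1,q_2<1$. Assume that $V_i\in C^1(0,\infty)$, $i=1,2$, and that there are constants $\bar q\in(\max\{q_1,q_2,0\},1)$ and $L>0$ such that $$\big|V_i'(y)+y^{q_i-1}\big|\le L\,y^{\bar q-1},\qquad 0<y\le1,\ i=1,2.$$ Then, as $t\to\infty$, $A(x,t)$ converges to $\frac{\theta}{\sigma}(1-\min\{q_1,q_2\})x$ exponentially if $q_1<q^*$ or $q_2<q^*$, and polynomially if $q_1\ge q^*$ and $q_2=q^*$. Furthermore, if for some $\hat q<0$ there is a constant $\tilde q<\min\{\hat q,q_2\}$ such that $$\big|V_2'(y)+y^{\hat q-1}\big|\le L\,y^{\tilde q-1},\qquad y\ge1,$$ then, as $t\to\infty$, $R(t)^{\frac{\hat q-1}{q_2-1}}C(x,t)$ converges to $x^{\frac{\hat q-1}{\min\{q_1,q_2\}-1}}$ exponentially if $q_1<q^*$ or $q_2<q^*$, and polynomially if $q_1\ge q^*$ and $q_2=q^*$, where, with $\lambda_i=\lambda(q_i)$, $$R(t)=\begin{cases} e^{\lambda_1 t}+\dfrac{e^{\lambda_2 t}-1}{\lambda_2}, & q_1=q_2,\\[2mm] e^{\frac{q_2-1}{q_1-1}\lambda_1 t}, & q_1<q_2,\\[2mm] \dfrac{e^{\lambda_2 t}-1}{\lambda_2}, & q_1>q_2,\end{cases}$$ and $(e^{\lambda_2 t}-1)/\lambda_2$ is read as $t$ if $\lambda_2=0$.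
   Context: Convergence rates. For functions $f$ on $(0,\infty)\times(0,\infty)$ and $g$ on $(0,\infty)$, $f(x,t)$ converges to $g(x)$ exponentially (respectively polynomially) as $t\to\infty$ if there exist constants $c>0$, $\bar T>0$ and a function $D$ on $(0,\infty)$ such that $|f(x,t)-g(x)|\le D(x)e^{-ct}$ (respectively $|f(x,t)-g(x)|\le D(x)t^{-c}$) for all $x>0$ and $t\ge\bar T$. Market and problem. Let $r>0$ (riskless rate), $\delta>0$ (discount rate), $\mu>0$, $\sigma>0$ be constants, $\theta=\sigma^{-1}(\mu-r)\neq0$ (Sharpe ratio), and $W$ a standard Brownian motion. Wealth satisfies $dX_s=rX_s\,ds+X_s\pi_s\sigma(\theta\,ds+dW_s)-c_s\,ds$, where $\pi_s$ is the proportion of wealth in the risky asset and $c_s\ge0$ is the consumption rate. The agent maximizes $E\big[\int_0^T e^{-\delta s}U_2(c_s)\,ds+e^{-\delta T}U_1(X_T)\big]$ over $(\pi,c)$. The variable $t$ denotes the time horizon (time remaining to the terminal date), so the distant-horizon limit is $t\to\infty$. Standing assumptions on utilities, $i=1,2$: $U_i$ is continuously differentiable, strictly increasing and strictly concave on $(0,\infty)$, $U_i(0)=0$, $U_i'(0)=\infty$, $U_i'(\infty)=0$, and $U_i(x)\le C_0(1+x^p)$ for $x\ge0$ and some constants $C_0>0$, $0<p<1$. The dual functions are $V_i(y)=\sup_{x\ge0}\{U_i(x)-xy\}$, $y>0$. Constants: $\alpha=\frac12+\frac{r-\delta}{\theta^2}$, $a=\frac{\theta}{\sqrt2}$, $\beta=-a^2\alpha^2-\delta$,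 and for $q<1$ $$\lambda(q)=\beta+(\alpha-q)^2a^2=\tfrac12\theta^2q(q-1)-rq+\delta(q-1).$$ The threshold $q^*=\alpha-\sqrt{\alpha^2+2\delta/\theta^2}<0$ is the unique root of $\lambda$ in $(-\infty,1)$. Optimal strategies. For $y>0$, $t>0$ (with $\pi$ in the next formula the number $3.14\ldots$) let $$I_i(y,t)=\frac{e^{\beta t}}{2\sqrt{\pi}}\int_{-\infty}^\infty e^{-\frac{\eta^2}{4}-(\alpha-1)a\sqrt t\,\eta}\,\big|V_i'(ye^{a\sqrt t\,\eta})\big|\,d\eta,\qquad v_y(y,t)=-I_1(y,t)-\int_0^tI_2(y,\tau)\,d\tau .$$ For $x>0$, $t>0$, let $y=y(x,t)>0$ be the unique solution of $x=-v_y(y,t)$. The optimal amount of money in the risky asset and the optimal consumption rate at wealth $x$ with horizon $t$ are $$A(x,t)=\frac{\theta}{\sigma}\,y\,v_{yy}(y,t),\qquad C(x,t)=-V_2'(y),\qquad y=y(x,t),$$ where $v_{yy}=\partial_y v_y$. *)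

theory Defs
  imports "HOL-Analysis.Analysis"
begin

definition converges_exponentially :: "(real \<Rightarrow> real \<Rightarrow> real) \<Rightarrow> (real \<Rightarrow> real) \<Rightarrow> bool" where
  "converges_exponentially f g \<longleftrightarrow>
    (\<exists>c>0. \<exists>T>0. \<exists>D :: real \<Rightarrow> real. \<forall>x>0. \<forall>t\<ge>T. \<bar>f x t - g x\<bar> \<le> D x * exp (- c * t))"

definition converges_polynomially :: "(real \<Rightarrow> real \<Rightarrow> real) \<Rightarrow> (real \<Rightarrow> real) \<Rightarrow> bool" where
  "converges_polynomially f g \<longleftrightarrow>
    (\<exists>c>0. \<exists>T>0. \<exists>D :: real \<Rightarrow> real. \<forall>x>0. \<forall>t\<ge>T. \<bar>f x t - g x\<bar> \<le> D x * t powr (- c))"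

definition strictly_concave_on :: "real set \<Rightarrow> (real \<Rightarrow> real) \<Rightarrow> bool" where
  "strictly_concave_on S f \<longleftrightarrow> convex S \<and>
    (\<forall>x\<in>S. \<forall>y\<in>S. \<forall>u. x \<noteq> y \<longrightarrow> 0 < u \<longrightarrow> u < 1 \<longrightarrow>
       (1 - u) * f x + u * f y < f ((1 - u) * x + u * y))"

text \<open>A utility is a function on \<open>[0,\<infinity>)\<close>; its values at negative arguments are irrelevant.\<close>

definition utility :: "(real \<Rightarrow> real) \<Rightarrow> bool" where
  "utility U \<longleftrightarrow>
     U C1_differentiable_on {0<..} \<and> strict_mono_on {0<..} U \<and> strictly_concave_on {0<..} U \<and>
     U 0 = 0 \<and> filterlim (deriv U) at_top (at_right 0) \<and> (deriv U \<longlongrightarrow> 0) at_top \<and>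
     (\<exists>C0>0. \<exists>p. 0 < p \<and> p < 1 \<and> (\<forall>x\<ge>0. U x \<le> C0 * (1 + x powr p)))"

text \<open>For a utility and \<open>y > 0\<close> the growth bound makes the supremum finite, so the
  conditionally complete \<open>SUP\<close> on the reals is the intended one.\<close>

definition dual_fun :: "(real \<Rightarrow> real) \<Rightarrow> real \<Rightarrow> real" where
  "dual_fun U y = (SUP x\<in>{0..}. U x - x * y)"

text \<open>Parameters throughout: riskless rate \<open>r\<close>, discount rate \<open>\<delta>\<close>, Sharpe ratio \<open>\<theta>\<close>,
  volatility \<open>\<sigma>\<close>.\<close>

definition alpha :: "real \<Rightarrow> real \<Rightarrow> real \<Rightarrow> real" where
  "alpha r \<delta> \<theta> = 1 / 2 + (r - \<delta>) / \<theta>\<^sup>2"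

definition acoef :: "real \<Rightarrow> real" where
  "acoef \<theta> = \<theta> / sqrt 2"

definition beta :: "real \<Rightarrow> real \<Rightarrow> real \<Rightarrow> real" where
  "beta r \<delta> \<theta> = - (acoef \<theta>)\<^sup>2 * (alpha r \<delta> \<theta>)\<^sup>2 - \<delta>"

definition lambda :: "real \<Rightarrow> real \<Rightarrow> real \<Rightarrow> real \<Rightarrow> real" where
  "lambda r \<delta> \<theta> q = beta r \<delta> \<theta> + (alpha r \<delta> \<theta> - q)\<^sup>2 * (acoef \<theta>)\<^sup>2"

definition qstar :: "real \<Rightarrow> real \<Rightarrow> real \<Rightarrow> real" where
  "qstar r \<delta> \<theta> = alpha r \<delta> \<theta> - sqrt ((alpha r \<delta> \<theta>)\<^sup>2 + 2 * \<delta> / \<theta>\<^sup>2)"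

lemma lambda_eq:
  assumes "\<theta> \<noteq> 0"
  shows "lambda r \<delta> \<theta> q = \<theta>\<^sup>2 * q * (q - 1) / 2 - r * q + \<delta> * (q - 1)"
  using assms unfolding lambda_def beta_def acoef_def alpha_def
  by (simp add: power_divide) (simp add: field_simps power2_eq_square)

text \<open>\<open>dual_marginal r \<delta> \<theta> V\<^sub>i y t\<close> is \<open>I\<^sub>i(y,t)\<close>.\<close>

definition dual_marginal :: "real \<Rightarrow> real \<Rightarrow> real \<Rightarrow> (real \<Rightarrow> real) \<Rightarrow> real \<Rightarrow> real \<Rightarrow> real" where
  "dual_marginal r \<delta> \<theta> V y t =
     exp (beta r \<delta> \<theta> * t) / (2 * sqrt pi) *
     (LBINT \<eta>. exp (- \<eta>\<^sup>2 / 4 - (alpha r \<delta> \<theta> - 1) * acoef \<theta> * sqrt t * \<eta>) *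
        \<bar>deriv V (y * exp (acoef \<theta> * sqrt t * \<eta>))\<bar>)"

definition dual_value_y ::
  "real \<Rightarrow> real \<Rightarrow> real \<Rightarrow> (real \<Rightarrow> real) \<Rightarrow> (real \<Rightarrow> real) \<Rightarrow> real \<Rightarrow> real \<Rightarrow> real" where
  "dual_value_y r \<delta> \<theta> V1 V2 y t =
     - dual_marginal r \<delta> \<theta> V1 y t - (LBINT \<tau>:{0..t}. dual_marginal r \<delta> \<theta> V2 y \<tau>)"

definition dual_point ::
  "real \<Rightarrow> real \<Rightarrow> real \<Rightarrow> (real \<Rightarrow> real) \<Rightarrow> (real \<Rightarrow> real) \<Rightarrow> real \<Rightarrow> real \<Rightarrow> real" where
  "dual_point r \<delta> \<theta> V1 V2 x t = (THE y. 0 < y \<and> x = - dual_value_y r \<delta> \<theta> V1 V2 y t)"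

definition optimal_amount ::
  "real \<Rightarrow> real \<Rightarrow> real \<Rightarrow> real \<Rightarrow> (real \<Rightarrow> real) \<Rightarrow> (real \<Rightarrow> real) \<Rightarrow> real \<Rightarrow> real \<Rightarrow> real" where
  "optimal_amount r \<delta> \<theta> \<sigma> V1 V2 x t =
     (let y = dual_point r \<delta> \<theta> V1 V2 x t
      in \<theta> / \<sigma> * y * deriv (\<lambda>z. dual_value_y r \<delta> \<theta> V1 V2 z t) y)"

definition optimal_consumption ::
  "real \<Rightarrow> real \<Rightarrow> real \<Rightarrow> (real \<Rightarrow> real) \<Rightarrow> (real \<Rightarrow> real) \<Rightarrow> real \<Rightarrow> real \<Rightarrow> real" where
  "optimal_consumption r \<delta> \<theta> V1 V2 x t = - deriv V2 (dual_point r \<delta> \<theta> V1 V2 x t)"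

definition exp_quot :: "real \<Rightarrow> real \<Rightarrow> real" where
  "exp_quot l t = (if l = 0 then t else (exp (l * t) - 1) / l)"

definition rate_fun :: "real \<Rightarrow> real \<Rightarrow> real \<Rightarrow> real \<Rightarrow> real \<Rightarrow> real \<Rightarrow> real" where
  "rate_fun r \<delta> \<theta> q1 q2 t =
     (let l1 = lambda r \<delta> \<theta> q1; l2 = lambda r \<delta> \<theta> q2 in
      if q1 = q2 then exp (l1 * t) + exp_quot l2 t
      else if q1 < q2 then exp ((q2 - 1) / (q1 - 1) * l1 * t)
      else exp_quot l2 t)"

end

theory Submission
  imports Defs "HOL-Probability.Distributions"
begin

text \<open>
  The kernel defining \<open>I\<^sub>i\<close> maps \<open>y powr (q - 1)\<close> to \<open>exp (lambda q * t) * y powr (q - 1)\<close>. Convexity of the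
  dual functions extends the bound \<open>L * y powr (qbar - 1)\<close> on \<open>V\<^sub>i' + y powr (q\<^sub>i - 1)\<close> to all \<open>y > 0\<close>, and since
  \<open>lambda qbar < 0\<close> its contribution to \<open>v\<^sub>y\<close> and \<open>y * v\<^sub>y\<^sub>y\<close> is \<open>O(y powr (qbar - 1))\<close> uniformly in time; for the
  derivative this uses the \<open>1 / sqrt t\<close> smoothing of the heat semigroup, which is integrable at \<open>t = 0\<close>. Hence
  \<open>x = y powr (q1 - 1) * exp (lambda1 * t) + y powr (q2 - 1) * exp_quot lambda2 t + O(y powr (qbar - 1))\<close> along the
  optimal \<open>y\<close>, which tends to infinity. Because \<open>lambda q / (1 - q)\<close> is strictly decreasing, the term
  with the smaller exponent dominates, and comparing with \<open>y * v\<^sub>y\<^sub>y\<close> and \<open>V2'\<close> gives both limits with rates.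
\<close>

subsection \<open>The heat semigroup on bounded functions\<close>

text \<open>The duals are only C^1, so \<open>v_yy\<close> cannot be formed by differentiating
  \<open>V_i'\<close> under the integral: the derivative has to fall on the Gaussian. The power
  terms are computed exactly, and all that is left of \<open>V_i'\<close> sits in a bounded function
  of ln y, so only semigroup estimates for bounded functions are needed. Positivity of qbar enters
  twice: the 1/y decay of the slope of a dual function stays below \<open>y powr (qbar - 1)\<close>
  for y >= 1, and \<open>lambda\<close> is negative on [0, 1]. The optimal y is a definite
  description, so wealth has to be strictly decreasing in y, which convexity of the duals alone does
  not give directly. The exponential and the polynomial claims are one argument: coefficients and
  errors are measured in powers of a scale S, which is \<open>exp\<close> in one regime and the
  identity in the other.\<close>

lemma has_real_derivative_lebesgue_integral:
  fixes f f' :: "real \<Rightarrow> 'a \<Rightarrow> real"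
  assumes e: "0 < e"
    and int: "\<And>x. \<bar>x - x0\<bar> < e \<Longrightarrow> integrable M (f x)"
    and meas: "f' x0 \<in> borel_measurable M"
    and deriv: "AE s in M. \<forall>x. \<bar>x - x0\<bar> < e \<longrightarrow> ((\<lambda>x. f x s) has_real_derivative f' x s) (at x)"
    and bound: "AE s in M. \<forall>x. \<bar>x - x0\<bar> < e \<longrightarrow> \<bar>f' x s\<bar> \<le> g s"
    and g: "integrable M g"
  shows "((\<lambda>x. \<integral>s. f x s \<partial>M) has_real_derivative (\<integral>s. f' x0 s \<partial>M)) (at x0)"
  unfolding has_field_derivative_iff tendsto_at_iff_sequentially
proof (intro allI impI)
  fix X :: "nat \<Rightarrow> real"
  assume X: "\<forall>i. X i \<in> UNIV - {x0}" and lim: "X \<longlonglongrightarrow> x0"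
  obtain N where N: "\<And>n. n \<ge> N \<Longrightarrow> \<bar>X n - x0\<bar> < e"
    using LIMSEQ_D[OF lim e] by (auto simp: real_norm_def)
  define Y where "Y n = X (n + N)" for n
  have Y: "\<bar>Y n - x0\<bar> < e" "Y n \<noteq> x0" for n using N X by (auto simp: Y_def)
  have limY: "Y \<longlonglongrightarrow> x0" unfolding Y_def using lim by (rule LIMSEQ_ignore_initial_segment)
  have "(\<lambda>n. \<integral>s. (f (Y n) s - f x0 s) / (Y n - x0) \<partial>M) \<longlonglongrightarrow> (\<integral>s. f' x0 s \<partial>M)"
  proof (rule integral_dominated_convergence[OF meas _ g])
    show "(\<lambda>s. (f (Y n) s - f x0 s) / (Y n - x0)) \<in> borel_measurable M" for n
      by (intro borel_measurable_divide borel_measurable_diff borel_measurable_const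
          borel_measurable_integrable[OF int] Y(1)) (simp add: e)
    show "AE s in M. (\<lambda>n. (f (Y n) s - f x0 s) / (Y n - x0)) \<longlonglongrightarrow> f' x0 s"
      using deriv
    proof eventually_elim
      case (elim s)
      then have "((\<lambda>x. f x s) has_real_derivative f' x0 s) (at x0)" using e by simp
      then have "((\<lambda>y. (f y s - f x0 s) / (y - x0)) \<longlongrightarrow> f' x0 s) (at x0)"
        by (simp add: has_field_derivative_iff)
      then show ?case using Y limY unfolding tendsto_at_iff_sequentially comp_def by blast
    qed
    \<comment> \<open>The mean value inequality on the ball turns the bound on the derivative into
      the same bound on the difference quotients, so \<open>g\<close> itself dominates.\<close>
    show "AE s in M. norm ((f (Y n) s - f x0 s) / (Y n - x0)) \<le> g s" for n
      using deriv bound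
    proof eventually_elim
      case (elim s)
      have "norm (f (Y n) s - f x0 s) \<le> g s * norm (Y n - x0)"
      proof (rule field_differentiable_bound[where S = "ball x0 e"])
        show "((\<lambda>x. f x s) has_real_derivative f' z s) (at z within ball x0 e)" if "z \<in> ball x0 e" for z
          using elim that by (auto simp: dist_real_def abs_minus_commute intro: has_field_derivative_at_within)
        show "norm (f' z s) \<le> g s" if "z \<in> ball x0 e" for z
          using elim that by (auto simp: dist_real_def abs_minus_commute)
      qed (use Y e in \<open>auto simp: dist_real_def abs_minus_commute\<close>)
      then show ?case using Y(2)[of n] by (simp add: field_simps)
    qed
  qed
  also have "(\<lambda>n. \<integral>s. (f (Y n) s - f x0 s) / (Y n - x0) \<partial>M)
      = (\<lambda>n. ((\<integral>s. f (Y n) s \<partial>M) - (\<integral>s. f x0 s \<partial>M)) / (Y n - x0))"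
  proof
    fix n
    have "integrable M (f (Y n))" by (rule int[OF Y(1)])
    moreover have "integrable M (f x0)" by (rule int) (simp add: e)
    ultimately show "(\<integral>s. (f (Y n) s - f x0 s) / (Y n - x0) \<partial>M)
        = ((\<integral>s. f (Y n) s \<partial>M) - (\<integral>s. f x0 s \<partial>M)) / (Y n - x0)"
      by (simp only: integral_divide_zero Bochner_Integration.integral_diff)
  qed
  finally have "(\<lambda>n. ((\<integral>s. f (Y n) s \<partial>M) - (\<integral>s. f x0 s \<partial>M)) / (Y n - x0))
      \<longlonglongrightarrow> (\<integral>s. f' x0 s \<partial>M)" .
  then show "((\<lambda>y. ((\<integral>s. f y s \<partial>M) - (\<integral>s. f x0 s \<partial>M)) / (y - x0)) \<circ> X) \<longlonglongrightarrow> (\<integral>s. f' x0 s \<partial>M)"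
    unfolding Y_def comp_def by (rule LIMSEQ_offset)
qed

text \<open>The normal density of variance 2 without its normalisation
  \<open>1 / (2 * sqrt pi)\<close>, as it occurs in the formula for I_i.\<close>

definition gauss :: "real \<Rightarrow> real" where
  "gauss u = exp (- u\<^sup>2 / 4)"

lemma gauss_pos [simp]: "0 < gauss u" and gauss_nonneg [simp]: "0 \<le> gauss u"
  by (simp_all add: gauss_def)

lemma gauss_measurable [measurable]: "gauss \<in> borel_measurable borel"
  unfolding gauss_def by measurable

lemma gauss_shift: "gauss (u + w) = gauss u * exp (- u * w / 2 - w\<^sup>2 / 4)"
  by (simp add: gauss_def mult_exp_exp power2_eq_square field_simps)

lemma has_real_derivative_gauss: "(gauss has_real_derivative - (u / 2 * gauss u)) (at u)"
  unfolding gauss_def by (auto intro!: derivative_eq_intros)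

lemma has_bochner_integral_gauss_exp:
  "has_bochner_integral lborel (\<lambda>u. gauss u * exp (k * u)) (2 * sqrt pi * exp (k\<^sup>2))"
proof -
  \<comment> \<open>Completing the square: the tilt moves the mean from 0 to 2k and costs the factor
    \<open>exp (k\<^sup>2)\<close>.\<close>
  have eq: "gauss u * exp (k * u) = 2 * sqrt pi * exp (k\<^sup>2) * normal_density (2 * k) (sqrt 2) u" for u
    by (simp add: gauss_def normal_density_def real_sqrt_mult mult_exp_exp power2_eq_square field_simps)
  have "has_bochner_integral lborel (normal_density (2 * k) (sqrt 2)) 1"
    by (simp add: has_bochner_integral_iff)
  from has_bochner_integral_mult_right[OF this, of "2 * sqrt pi * exp (k\<^sup>2)"]
  show ?thesis unfolding eq by simp
qed

lemma has_bochner_integral_gauss: "has_bochner_integral lborel gauss (2 * sqrt pi)"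
  using has_bochner_integral_gauss_exp[of 0] by simp

text \<open>The majorant used below: an exponential in |u| absorbs both a linear factor and a
  bounded shift of the Gaussian.\<close>

lemma integrable_gauss_exp_abs: "integrable lborel (\<lambda>u. gauss u * exp (k * \<bar>u\<bar>))"
proof (rule Bochner_Integration.integrable_bound)
  show "integrable lborel (\<lambda>u. gauss u * exp (k * u) + gauss u * exp (- k * u))"
    using has_bochner_integral_gauss_exp[of k] has_bochner_integral_gauss_exp[of "- k"]
    by (intro Bochner_Integration.integrable_add) (auto simp: has_bochner_integral_iff)
  have "\<bar>gauss u * exp (k * \<bar>u\<bar>)\<bar> \<le> gauss u * exp (k * u) + gauss u * exp (- k * u)" for u
    by (cases "u \<ge> 0") (auto simp: abs_mult)
  then show "AE u in lborel. norm (gauss u * exp (k * \<bar>u\<bar>))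
      \<le> norm (gauss u * exp (k * u) + gauss u * exp (- k * u))"
    by (intro AE_I2) (metis abs_ge_self order_trans real_norm_def)
qed measurable

lemma integrable_abs_gauss: "integrable lborel (\<lambda>u. \<bar>u\<bar> * gauss u)"
proof (rule Bochner_Integration.integrable_bound[OF integrable_gauss_exp_abs[of 1]])
  have "\<bar>u\<bar> \<le> exp \<bar>u\<bar>" for u :: real using exp_ge_add_one_self[of "\<bar>u\<bar>"] by linarith
  then show "AE u in lborel. norm (\<bar>u\<bar> * gauss u) \<le> norm (gauss u * exp (1 * \<bar>u\<bar>))"
    by (auto simp: abs_mult mult.commute intro!: mult_left_mono)
qed auto

text \<open>Solution at time c^2 of the heat equation with initial value h. The parameter is c
  rather than c^2 because the model supplies \<open>a * sqrt t\<close>, whose sign is that of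
  \<theta>.\<close>

definition heat :: "(real \<Rightarrow> real) \<Rightarrow> real \<Rightarrow> real \<Rightarrow> real" where
  "heat h c z = (LBINT u. gauss u * h (z + c * u)) / (2 * sqrt pi)"

text \<open>The z-derivative of \<open>heat\<close> with the differentiation moved onto the
  Gaussian; the factor u comes from its logarithmic derivative, and h need not be
  differentiable.\<close>

definition heat_deriv :: "(real \<Rightarrow> real) \<Rightarrow> real \<Rightarrow> real \<Rightarrow> real" where
  "heat_deriv h c z = (LBINT u. u * gauss u * h (z + c * u)) / (4 * c * sqrt pi)"

definition gauss_moment :: real where
  "gauss_moment = (LBINT u. \<bar>u\<bar> * gauss u) / (4 * sqrt pi)"

lemma gauss_moment_nonneg: "0 \<le> gauss_moment"
  unfolding gauss_moment_def by (intro divide_nonneg_nonneg integral_nonneg_AE) auto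

context
  fixes h :: "real \<Rightarrow> real" and B :: real
  assumes h_measurable [measurable]: "h \<in> borel_measurable borel" and h_bound: "\<And>s. \<bar>h s\<bar> \<le> B"
begin

lemma bound_nonneg: "0 \<le> B"
  using h_bound[of 0] by linarith

lemma integrable_heat: "integrable lborel (\<lambda>u. gauss u * h (z + c * u))"
proof (rule Bochner_Integration.integrable_bound)
  show "integrable lborel (\<lambda>u. B * gauss u)"
    using has_bochner_integral_gauss by (auto simp: has_bochner_integral_iff)
  show "AE u in lborel. norm (gauss u * h (z + c * u)) \<le> norm (B * gauss u)"
    using h_bound bound_nonneg by (auto simp: abs_mult mult.commute intro!: mult_right_mono)
qed measurable

lemma heat_bound: "\<bar>heat h c z\<bar> \<le> B"
proof -
  have "\<bar>LBINT u. gauss u * h (z + c * u)\<bar> \<le> (LBINT u. B * gauss u)"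
    using has_bochner_integral_gauss h_bound
    by (intro integral_abs_bound_integral integrable_heat)
       (auto simp: has_bochner_integral_iff abs_mult mult.commute intro!: mult_right_mono)
  also have "\<dots> = B * (2 * sqrt pi)"
    using has_bochner_integral_gauss by (auto simp: has_bochner_integral_iff)
  finally show ?thesis by (simp add: heat_def field_simps)
qed

lemma integrable_heat_deriv: "integrable lborel (\<lambda>u. u * gauss u * h (z + c * u))"
proof (rule Bochner_Integration.integrable_bound)
  show "integrable lborel (\<lambda>u. B * (\<bar>u\<bar> * gauss u))"
    using integrable_abs_gauss by auto
  show "AE u in lborel. norm (u * gauss u * h (z + c * u)) \<le> norm (B * (\<bar>u\<bar> * gauss u))"
  proof (rule AE_I2)
    fix u show "norm (u * gauss u * h (z + c * u)) \<le> norm (B * (\<bar>u\<bar> * gauss u))"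
      using mult_right_mono[OF h_bound[of "z + c * u"], of "\<bar>u\<bar> * gauss u"] bound_nonneg
      by (simp add: abs_mult mult_ac)
  qed
qed measurable

lemma heat_deriv_bound:
  assumes "c \<noteq> 0"
  shows "\<bar>heat_deriv h c z\<bar> \<le> B * gauss_moment / \<bar>c\<bar>"
proof -
  have "\<bar>LBINT u. u * gauss u * h (z + c * u)\<bar> \<le> (LBINT u. B * (\<bar>u\<bar> * gauss u))"
    using integrable_abs_gauss h_bound
    by (intro integral_abs_bound_integral integrable_heat_deriv)
       (auto simp: abs_mult mult.commute[of B] intro!: mult_left_mono)
  then show ?thesis using assms
    by (simp add: heat_deriv_def gauss_moment_def abs_mult field_simps)
qed

lemma heat_measurable [measurable]: "(\<lambda>(c, z). heat h c z) \<in> borel_measurable (borel \<Otimes>\<^sub>M borel)"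
  unfolding heat_def by measurable

lemma heat_deriv_measurable [measurable]:
  "(\<lambda>(c, z). heat_deriv h c z) \<in> borel_measurable (borel \<Otimes>\<^sub>M borel)"
  unfolding heat_deriv_def by measurable

text \<open>Since h is merely bounded and measurable, translating u by z/c first moves z out of the
  argument of h into the Gaussian. This is where c must not vanish.\<close>

lemma heat_has_derivative:
  assumes c: "c \<noteq> 0"
  shows "(heat h c has_real_derivative heat_deriv h c z) (at z)"
proof -
  have shift: "(LBINT u. F u (z + c * u)) = (LBINT u. F (u - z / c) (c * u))"
    for F :: "real \<Rightarrow> real \<Rightarrow> real" and z
    using lborel_integral_real_affine[of 1 "\<lambda>u. F (u - z / c) (c * u)" "z / c"] c
    by (simp add: algebra_simps)
  have ishift: "integrable lborel (\<lambda>u. F (u - z / c) (c * u)) \<longleftrightarrow> integrable lborel (\<lambda>u. F u (z + c * u))"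
    for F :: "real \<Rightarrow> real \<Rightarrow> real" and z
    using lborel_integrable_real_affine_iff[of 1 "\<lambda>u. F (u - z / c) (c * u)" "z / c"] c
    by (simp add: algebra_simps)
  define f where "f z u = gauss (u - z / c) * h (c * u)" for z u
  define f' where "f' z u = (u - z / c) / (2 * c) * gauss (u - z / c) * h (c * u)" for z u
  define g where "g u = B / (2 * \<bar>c\<bar>) * (gauss (u - z / c) * exp (2 * \<bar>u - z / c\<bar>))" for u
  have "((\<lambda>x. \<integral>s. f x s \<partial>lborel) has_real_derivative (\<integral>s. f' z s \<partial>lborel)) (at z)"
  proof (rule has_real_derivative_lebesgue_integral[where e = "\<bar>c\<bar>" and g = g])
    show "integrable lborel (f x)" for x
      unfolding f_def using ishift[of "\<lambda>u v. gauss u * h v"] integrable_heat by simp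
    show "f' z \<in> borel_measurable lborel" unfolding f'_def by measurable
    show "integrable lborel g"
      unfolding g_def
      using lborel_integrable_real_affine[OF integrable_gauss_exp_abs[of 2], of 1 "- z / c"]
      by (intro integrable_mult_right) simp
    have "((\<lambda>x. f x s) has_real_derivative f' x s) (at x)" for s x
      unfolding f_def f'_def using c
      by (auto intro!: derivative_eq_intros has_real_derivative_gauss[THEN DERIV_chain2] simp: field_simps)
    then show "AE s in lborel. \<forall>x. \<bar>x - z\<bar> < \<bar>c\<bar> \<longrightarrow> ((\<lambda>x. f x s) has_real_derivative f' x s) (at x)"
      by simp
    \<comment> \<open>The window |x - z| < |c| shifts the Gaussian by at most one unit. The shift
      costs \<open>exp \<bar>v\<bar>\<close>, the linear factor another
      \<open>exp \<bar>v\<bar>\<close>, which explains the 2 in the exponent of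
      \<open>g\<close>.\<close>
    have "\<bar>f' x s\<bar> \<le> g s" if "\<bar>x - z\<bar> < \<bar>c\<bar>" for x s
    proof -
      define v where "v = s - z / c"
      define w where "w = (z - x) / c"
      have w: "\<bar>w\<bar> \<le> 1" using that c by (simp add: w_def abs_divide field_simps)
      have svw: "s - x / c = v + w" by (simp add: v_def w_def diff_divide_distrib)
      have "gauss (v + w) \<le> gauss v * exp \<bar>v\<bar>"
      proof -
        have "- v * w / 2 \<le> \<bar>v * w\<bar>" by (auto simp: abs_if)
        also have "\<dots> \<le> \<bar>v\<bar>" using w by (simp add: abs_mult mult_left_le)
        finally have "- v * w / 2 - w\<^sup>2 / 4 \<le> \<bar>v\<bar>" using zero_le_power2[of w] by linarith
        then show ?thesis unfolding gauss_shift by (intro mult_left_mono) auto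
      qed
      moreover have "\<bar>v + w\<bar> \<le> exp \<bar>v\<bar>"
        using exp_ge_add_one_self[of "\<bar>v\<bar>"] w abs_triangle_ineq[of v w] by linarith
      ultimately have "\<bar>v + w\<bar> * gauss (v + w) \<le> exp \<bar>v\<bar> * (gauss v * exp \<bar>v\<bar>)"
        by (intro mult_mono) auto
      then have "\<bar>v + w\<bar> * gauss (v + w) \<le> gauss v * exp (2 * \<bar>v\<bar>)"
        by (simp add: mult_exp_exp mult.left_commute)
      then have "\<bar>v + w\<bar> * gauss (v + w) * \<bar>h (c * s)\<bar> \<le> gauss v * exp (2 * \<bar>v\<bar>) * B"
        by (rule mult_mono[OF _ h_bound]) auto
      then have "\<bar>v + w\<bar> * gauss (v + w) * \<bar>h (c * s)\<bar> / (2 * \<bar>c\<bar>) \<le> gauss v * exp (2 * \<bar>v\<bar>) * B / (2 * \<bar>c\<bar>)"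
        by (rule divide_right_mono) auto
      then show ?thesis
        unfolding f'_def g_def svw by (simp add: abs_mult v_def mult_ac)
    qed
    then show "AE s in lborel. \<forall>x. \<bar>x - z\<bar> < \<bar>c\<bar> \<longrightarrow> \<bar>f' x s\<bar> \<le> g s" by simp
  qed (use c in auto)
  from DERIV_cdivide[OF this, of "2 * sqrt pi"]
  moreover have "(\<integral>s. f x s \<partial>lborel) / (2 * sqrt pi) = heat h c x" for x
    unfolding heat_def f_def using shift[of "\<lambda>u v. gauss u * h v"] by simp
  moreover have "(\<integral>s. f' z s \<partial>lborel) / (2 * sqrt pi) = heat_deriv h c z"
  proof -
    have "(\<integral>s. f' z s \<partial>lborel) = (LBINT u. u / (2 * c) * gauss u * h (z + c * u))"
      unfolding f'_def by (rule shift[of "\<lambda>u v. u / (2 * c) * gauss u * h v", symmetric])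
    also have "\<dots> = (LBINT u. u * gauss u * h (z + c * u)) / (2 * c)"
      by (simp flip: integral_divide_zero)
    finally show ?thesis
      unfolding heat_deriv_def by simp
  qed
  ultimately show ?thesis by simp
qed

end

subsection \<open>Dual functions and their marginals\<close>

lemma bdd_above_dual:
  assumes U: "utility U" and y: "0 < y"
  shows "bdd_above ((\<lambda>x. U x - x * y) ` {0..})"
proof -
  obtain C p where C: "0 < C" and p: "0 < p" "p < 1" and le: "\<And>x. x \<ge> 0 \<Longrightarrow> U x \<le> C * (1 + x powr p)"
    using U unfolding utility_def by metis
  \<comment> \<open>At x = M the growth bound C x^p equals the linear cost x y; beyond M the cost
    wins.\<close>
  define M where "M = (C / y) powr (1 / (1 - p))"
  have "U x - x * y \<le> C + C * M powr p" if x: "x \<ge> 0" for x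
  proof (cases "x \<le> M")
    case True
    then have "x powr p \<le> M powr p" using x p by (intro powr_mono2) auto
    then have "C * x powr p \<le> C * M powr p" using C by simp
    moreover have "0 \<le> x * y" using x y by simp
    ultimately show ?thesis using le[OF x] by (simp add: distrib_left)
  next
    case False
    have M: "0 < M" using C y by (simp add: M_def)
    then have x0: "0 < x" using False by simp
    have "C / y = M powr (1 - p)" using C y p by (simp add: M_def powr_powr)
    also have "\<dots> \<le> x powr (1 - p)" using False M p by (intro powr_mono2) auto
    finally have "C \<le> y * x powr (1 - p)" using y by (simp add: field_simps)
    then have "C * x powr p \<le> y * x powr (1 - p) * x powr p" by (intro mult_right_mono) auto
    also have "\<dots> = x * y" using x0 by (simp add: powr_add[symmetric])
    finally have "C * x powr p \<le> x * y" .
    moreover have "0 \<le> C * M powr p" using C by simp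
    ultimately show ?thesis using le[OF x] by (simp add: distrib_left)
  qed
  then show ?thesis by (intro bdd_aboveI2[where M = "C + C * M powr p"]) auto
qed

lemma dual_fun_upper:
  assumes "utility U" "0 < y" "0 \<le> x"
  shows "U x - x * y \<le> dual_fun U y"
  unfolding dual_fun_def using bdd_above_dual[OF assms(1,2)] assms(3) by (intro cSUP_upper) auto

lemma dual_fun_least:
  assumes "\<And>x. 0 \<le> x \<Longrightarrow> U x - x * y \<le> z"
  shows "dual_fun U y \<le> z"
  unfolding dual_fun_def using assms by (intro cSUP_least) auto

lemma dual_fun_nonneg:
  assumes "utility U" "0 < y"
  shows "0 \<le> dual_fun U y"
  using dual_fun_upper[OF assms, of 0] assms(1) by (simp add: utility_def)

lemma dual_fun_antimono:
  assumes U: "utility U" and y: "0 < y" "y \<le> y'"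
  shows "dual_fun U y' \<le> dual_fun U y"
proof (rule dual_fun_least)
  fix x :: real assume x: "0 \<le> x"
  then have "x * y \<le> x * y'" using y by (intro mult_left_mono) auto
  then show "U x - x * y' \<le> dual_fun U y" using dual_fun_upper[OF U y(1) x] by linarith
qed

lemma convex_on_dual_fun:
  assumes U: "utility U"
  shows "convex_on {0<..} (dual_fun U)"
proof (rule convex_onI)
  fix t a b :: real assume t: "0 < t" "t < 1" and a: "a \<in> {0<..}" and b: "b \<in> {0<..}"
  show "dual_fun U ((1 - t) *\<^sub>R a + t *\<^sub>R b) \<le> (1 - t) * dual_fun U a + t * dual_fun U b"
  proof (rule dual_fun_least)
    fix x :: real assume x: "0 \<le> x"
    have "(1 - t) * (U x - x * a) + t * (U x - x * b) \<le> (1 - t) * dual_fun U a + t * dual_fun U b"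
      using dual_fun_upper[OF U _ x] a b t by (intro add_mono mult_left_mono) auto
    then show "U x - x * ((1 - t) *\<^sub>R a + t *\<^sub>R b) \<le> (1 - t) * dual_fun U a + t * dual_fun U b"
      by (simp add: algebra_simps)
  qed
qed simp

lemma C1_differentiable_on_deriv:
  fixes f :: "real \<Rightarrow> real"
  assumes "f C1_differentiable_on S"
  shows "x \<in> S \<Longrightarrow> (f has_real_derivative deriv f x) (at x)" and "continuous_on S (deriv f)"
proof -
  obtain D where D: "\<And>x. x \<in> S \<Longrightarrow> (f has_vector_derivative D x) (at x)" and cont: "continuous_on S D"
    using assms unfolding C1_differentiable_on_def by blast
  have eq: "deriv f x = D x" and der: "(f has_real_derivative deriv f x) (at x)" if "x \<in> S" for x
  proof -
    have *: "(f has_real_derivative D x) (at x)"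
      using D[OF that] by (simp add: has_real_derivative_iff_has_vector_derivative)
    then show "deriv f x = D x" by (rule DERIV_imp_deriv)
    with * show "(f has_real_derivative deriv f x) (at x)" by simp
  qed
  show "x \<in> S \<Longrightarrow> (f has_real_derivative deriv f x) (at x)" by (rule der)
  show "continuous_on S (deriv f)" using cont by (simp add: eq cong: continuous_on_cong)
qed

context
  fixes U :: "real \<Rightarrow> real"
  assumes U: "utility U" and C1: "dual_fun U C1_differentiable_on {0<..}"
begin

lemma dual_fun_above_tangent:
  assumes "0 < x" "0 < y"
  shows "deriv (dual_fun U) y * (x - y) \<le> dual_fun U x - dual_fun U y"
  using convex_on_imp_above_tangent[OF convex_on_dual_fun[OF U], of y x "deriv (dual_fun U) y"]
    C1_differentiable_on_deriv(1)[OF C1, of y] assms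
  by (auto intro: has_field_derivative_at_within simp: interior_open connected_Ioi)

lemma deriv_dual_fun_nonpos:
  assumes "0 < y"
  shows "deriv (dual_fun U) y \<le> 0"
  using dual_fun_above_tangent[of "y + 1" y] dual_fun_antimono[OF U assms, of "y + 1"] assms by simp

lemma deriv_dual_fun_mono:
  assumes "0 < x" "x \<le> y"
  shows "deriv (dual_fun U) x \<le> deriv (dual_fun U) y"
proof (cases "x = y")
  case False
  have "deriv (dual_fun U) x * (y - x) \<le> deriv (dual_fun U) y * (y - x)"
    using dual_fun_above_tangent[of x y] dual_fun_above_tangent[of y x] assms by (simp add: algebra_simps)
  then show ?thesis using False assms by simp
qed simp

text \<open>Convexity turns boundedness of the dual function away from the origin into decay of its slope.\<close>

lemma deriv_dual_fun_decay:
  assumes "1 \<le> y"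
  shows "- deriv (dual_fun U) y \<le> 2 * dual_fun U (1 / 2) / y"
proof -
  have "- deriv (dual_fun U) y * (y / 2) \<le> - deriv (dual_fun U) y * (y - 1 / 2)"
    using assms deriv_dual_fun_nonpos[of y] by (intro mult_left_mono) auto
  also have "\<dots> \<le> dual_fun U (1 / 2)"
    using dual_fun_above_tangent[of "1 / 2" y] dual_fun_nonneg[OF U, of y] assms
    by (simp add: algebra_simps)
  finally show ?thesis using assms by (simp add: field_simps)
qed

lemma deriv_dual_fun_near_power:
  assumes q: "q < b" "0 < b" and L: "0 < L"
    and near: "\<And>y. 0 < y \<Longrightarrow> y \<le> 1 \<Longrightarrow> \<bar>deriv (dual_fun U) y + y powr (q - 1)\<bar> \<le> L * y powr (b - 1)"
  obtains K where "0 < K"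
    "\<And>y. 0 < y \<Longrightarrow> \<bar>\<bar>deriv (dual_fun U) y\<bar> - y powr (q - 1)\<bar> \<le> K * y powr (b - 1)"
proof
  define C where "C = 2 * dual_fun U (1 / 2)"
  have C: "0 \<le> C" using dual_fun_nonneg[OF U, of "1 / 2"] by (simp add: C_def)
  show "0 < L + C + 1" using L C by simp
  fix y :: real assume y: "0 < y"
  have abs: "\<bar>deriv (dual_fun U) y\<bar> = - deriv (dual_fun U) y" using deriv_dual_fun_nonpos[OF y] by simp
  show "\<bar>\<bar>deriv (dual_fun U) y\<bar> - y powr (q - 1)\<bar> \<le> (L + C + 1) * y powr (b - 1)"
  proof (cases "y \<le> 1")
    case True
    have "\<bar>\<bar>deriv (dual_fun U) y\<bar> - y powr (q - 1)\<bar> \<le> L * y powr (b - 1)"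
      using near[OF y True] abs by linarith
    also have "\<dots> \<le> (L + C + 1) * y powr (b - 1)" using C by (intro mult_right_mono) auto
    finally show ?thesis .
  next
    case False
    have "\<bar>deriv (dual_fun U) y\<bar> \<le> C * y powr (- 1)"
      unfolding abs using deriv_dual_fun_decay[of y] False y by (simp add: C_def powr_neg_one)
    also have "\<dots> \<le> C * y powr (b - 1)" using False q C by (intro mult_left_mono powr_mono) auto
    finally have "\<bar>deriv (dual_fun U) y\<bar> \<le> C * y powr (b - 1)" .
    moreover have "y powr (q - 1) \<le> y powr (b - 1)" using False q by (intro powr_mono) auto
    moreover have "0 \<le> L * y powr (b - 1)" using L by simp
    ultimately have "\<bar>deriv (dual_fun U) y\<bar> + y powr (q - 1) \<le> (L + C + 1) * y powr (b - 1)"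
      by (simp add: algebra_simps)
    then show ?thesis using powr_ge_zero[of y "q - 1"] by linarith
  qed
qed

end

section \<open>The market constants and the sign of \<open>lambda\<close> on the unit
  interval\<close>

locale market =
  fixes r \<delta> \<theta> :: real
  assumes r: "0 < r" and \<delta>: "0 < \<delta>" and \<theta>: "\<theta> \<noteq> 0"
begin

abbreviation "\<alpha> \<equiv> alpha r \<delta> \<theta>"
abbreviation "a \<equiv> acoef \<theta>"
abbreviation "\<beta> \<equiv> beta r \<delta> \<theta>"
abbreviation "\<Lambda> \<equiv> lambda r \<delta> \<theta>"

lemma a_nonzero: "a \<noteq> 0"
  using \<theta> by (simp add: acoef_def)

text \<open>The quadratic part vanishes at 0 and 1 and is nonpositive in between, and the affine
  part runs from -\<delta> to -r.\<close>

lemma lambda_neg: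
  assumes "0 \<le> q" "q \<le> 1"
  shows "\<Lambda> q < 0"
proof -
  have "\<theta>\<^sup>2 * q * (q - 1) / 2 \<le> 0"
    using assms by (simp add: mult_nonneg_nonpos)
  moreover have "- r * q + \<delta> * (q - 1) < 0"
  proof (cases "q = 0")
    case False
    then have "0 < r * q" using assms r by simp
    moreover have "\<delta> * (q - 1) \<le> 0" using assms \<delta> by (simp add: mult_nonneg_nonpos)
    ultimately show ?thesis by simp
  qed (use \<delta> in simp)
  ultimately show ?thesis unfolding lambda_eq[OF \<theta>] by linarith
qed

end

section \<open>Splitting the marginal into an exact power and a bounded remainder\<close>

locale dual_asymptotics = market +
  fixes V :: "real \<Rightarrow> real" and q b K :: real
  assumes cont: "continuous_on {0<..} (deriv V)"
    and antimono: "\<And>x y. 0 < x \<Longrightarrow> x \<le> y \<Longrightarrow> \<bar>deriv V y\<bar> \<le> \<bar>deriv V x\<bar>"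
    and approx: "\<And>y. 0 < y \<Longrightarrow> \<bar>\<bar>deriv V y\<bar> - y powr (q - 1)\<bar> \<le> K * y powr (b - 1)"
    and q: "q < b" and b: "0 < b" "b < 1"
begin

text \<open>The deviation of |V'| from the pure power, in the variable s = ln y and divided by the
  weight \<open>y powr (b - 1)\<close>. It is bounded by K on the whole line.\<close>

definition profile :: "real \<Rightarrow> real" where
  "profile s = (\<bar>deriv V (exp s)\<bar> - exp ((q - 1) * s)) * exp (- (b - 1) * s)"

lemma profile_measurable [measurable]: "profile \<in> borel_measurable borel"
proof (rule borel_measurable_continuous_onI)
  have "continuous_on UNIV (\<lambda>s. deriv V (exp s))"
    by (rule continuous_on_compose2[OF cont]) (auto intro!: continuous_intros)
  then show "continuous_on UNIV profile"
    unfolding profile_def by (intro continuous_intros)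
qed

lemma profile_bound: "\<bar>profile s\<bar> \<le> K"
proof -
  have "\<bar>profile s\<bar> = \<bar>\<bar>deriv V (exp s)\<bar> - exp ((q - 1) * s)\<bar> * exp (- (b - 1) * s)"
    by (simp add: profile_def abs_mult)
  also have "\<dots> \<le> K * exp ((b - 1) * s) * exp (- (b - 1) * s)"
    using approx[of "exp s"] by (intro mult_right_mono) (simp_all add: powr_def)
  also have "\<dots> = K" by (simp add: mult_exp_exp mult.assoc algebra_simps)
  finally show ?thesis .
qed

lemma abs_deriv_eq: "\<bar>deriv V (exp s)\<bar> = exp ((q - 1) * s) + exp ((b - 1) * s) * profile s"
proof -
  have "exp ((b - 1) * s) * exp (- (b - 1) * s) = 1" by (simp add: mult_exp_exp algebra_simps)
  then show ?thesis by (simp add: profile_def mult.left_commute[of "exp ((b - 1) * s)"])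
qed

lemma K_nonneg: "0 \<le> K"
  using profile_bound[of 0] by linarith

text \<open>The value ln y + 2 (b - \<alpha>) a^2 t: the starting point ln y moved by the mean of
  the tilted Gaussian.\<close>

definition drift :: "real \<Rightarrow> real \<Rightarrow> real" where
  "drift y t = ln y - 2 * (\<alpha> - b) * a\<^sup>2 * t"

definition rem :: "real \<Rightarrow> real \<Rightarrow> real" where
  "rem y t = y powr (b - 1) * exp (\<Lambda> b * t) * heat profile (a * sqrt t) (drift y t)"

definition rem_deriv :: "real \<Rightarrow> real \<Rightarrow> real" where
  "rem_deriv y t = y powr (b - 1) / y * exp (\<Lambda> b * t) *
     ((b - 1) * heat profile (a * sqrt t) (drift y t) + heat_deriv profile (a * sqrt t) (drift y t))"

definition integrand :: "real \<Rightarrow> real \<Rightarrow> real \<Rightarrow> real" where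
  "integrand y t \<eta> = exp (- \<eta>\<^sup>2 / 4 - (\<alpha> - 1) * a * sqrt t * \<eta>) * \<bar>deriv V (y * exp (a * sqrt t * \<eta>))\<bar>"

text \<open>The Gaussian is recentred so that the exponential tilt is absorbed into the drift.\<close>

lemma has_bochner_integral_integrand:
  assumes y: "0 < y" and t: "0 \<le> t"
  shows "has_bochner_integral lborel (integrand y t)
    (2 * sqrt pi * exp (- \<beta> * t) * (y powr (q - 1) * exp (\<Lambda> q * t) + rem y t))"
proof -
  define c where "c = a * sqrt t"
  have c2: "c\<^sup>2 = a\<^sup>2 * t" using t by (simp add: c_def power_mult_distrib)
  \<comment> \<open>The tilt -(\<alpha> - 1) c u of the kernel and the exponent (b - 1) c u from the
    weight add up to k u. Shifting u by 2k removes it at the cost of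
    \<open>exp (k\<^sup>2)\<close>.\<close>
  define k where "k = (b - \<alpha>) * c"
  have 1: "has_bochner_integral lborel (\<lambda>u. y powr (q - 1) * (gauss u * exp ((q - \<alpha>) * c * u)))
      (y powr (q - 1) * (2 * sqrt pi * exp (((q - \<alpha>) * c)\<^sup>2)))"
    by (rule has_bochner_integral_mult_right) (rule has_bochner_integral_gauss_exp)
  have heat: "has_bochner_integral lborel (\<lambda>u. gauss u * profile (drift y t + c * u))
      (2 * sqrt pi * heat profile c (drift y t))"
    using integrable_heat[OF profile_measurable profile_bound, of "drift y t" c]
    by (simp add: has_bochner_integral_iff heat_def)
  have tilt: "gauss (- 2 * k + u) * profile (drift y t + c * (- 2 * k + u)) =
      exp (- (k\<^sup>2)) * (gauss u * exp (k * u) * profile (ln y + c * u))" for u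
  proof -
    have "2 * k * c = 2 * (b - \<alpha>) * (a\<^sup>2 * t)"
      unfolding k_def c2[symmetric] by (simp add: power2_eq_square)
    then have "drift y t + c * (- 2 * k + u) = ln y + c * u"
      by (simp add: drift_def algebra_simps)
    moreover have "gauss (u + - 2 * k) = exp (- (k\<^sup>2)) * (gauss u * exp (k * u))"
      unfolding gauss_shift by (simp add: mult_exp_exp mult.left_commute power2_eq_square algebra_simps)
    ultimately show ?thesis by (simp add: add.commute mult_ac)
  qed
  have "has_bochner_integral lborel (\<lambda>u. gauss u * exp (k * u) * profile (ln y + c * u))
      (exp (k\<^sup>2) * (2 * sqrt pi * heat profile c (drift y t)))"
  proof -
    have "has_bochner_integral lborel (\<lambda>u. exp (- (k\<^sup>2)) * (gauss u * exp (k * u) * profile (ln y + c * u)))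
        (2 * sqrt pi * heat profile c (drift y t))"
      using heat lborel_has_bochner_integral_real_affine_iff[of 1 "\<lambda>u. gauss u * profile (drift y t + c * u)"
          "2 * sqrt pi * heat profile c (drift y t)" "- 2 * k"]
      unfolding tilt[symmetric] by simp
    from has_bochner_integral_mult_right[OF this, of "exp (k\<^sup>2)"]
    show ?thesis by (simp add: mult_exp_exp mult.assoc[symmetric] del: mult.assoc)
  qed
  from has_bochner_integral_mult_right[OF this, of "y powr (b - 1)"]
  have 2: "has_bochner_integral lborel (\<lambda>u. y powr (b - 1) * (gauss u * exp (k * u) * profile (ln y + c * u)))
      (y powr (b - 1) * (exp (k\<^sup>2) * (2 * sqrt pi * heat profile c (drift y t))))" by simp
  have split: "integrand y t u = y powr (q - 1) * (gauss u * exp ((q - \<alpha>) * c * u)) +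
      y powr (b - 1) * (gauss u * exp (k * u) * profile (ln y + c * u))" for u
  proof -
    have yu: "y * exp (c * u) = exp (ln y + c * u)" using y by (simp add: exp_add)
    have e: "exp (- u\<^sup>2 / 4 - (\<alpha> - 1) * c * u) * exp ((p - 1) * (ln y + c * u)) =
        y powr (p - 1) * (gauss u * exp ((p - \<alpha>) * c * u))" for p
      using y unfolding powr_def gauss_def by (simp add: mult_exp_exp algebra_simps)
    show ?thesis
      unfolding integrand_def c_def[symmetric] mult.assoc[of _ a] yu abs_deriv_eq
      using e[of q] e[of b] by (simp add: distrib_left k_def mult.assoc[symmetric])
  qed
  \<comment> \<open>Here \<open>lambda\<close> arises: the squared tilt (\<alpha> - p)^2 a^2 t is
    (\<open>\<Lambda> p\<close> - \<beta>) t, and the prefactor of the marginal removes the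
    \<beta>.\<close>
  have lam: "exp (((p - \<alpha>) * c)\<^sup>2) = exp (- \<beta> * t) * exp (\<Lambda> p * t)" for p
  proof -
    have "((p - \<alpha>) * c)\<^sup>2 = (\<alpha> - p)\<^sup>2 * (a\<^sup>2 * t)"
      by (simp only: power_mult_distrib c2 power2_commute[of p])
    then show ?thesis by (simp add: mult_exp_exp lambda_def algebra_simps)
  qed
  show ?thesis
    using has_bochner_integral_add[OF 1 2] unfolding split lam k_def rem_def c_def[symmetric]
    by (simp add: algebra_simps)
qed

lemma dual_marginal_integrand:
  "dual_marginal r \<delta> \<theta> V y t = exp (\<beta> * t) / (2 * sqrt pi) * (LBINT \<eta>. integrand y t \<eta>)"
  by (simp add: dual_marginal_def integrand_def)

lemma dual_marginal_eq:
  assumes "0 < y" "0 \<le> t"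
  shows "dual_marginal r \<delta> \<theta> V y t = y powr (q - 1) * exp (\<Lambda> q * t) + rem y t"
  unfolding dual_marginal_integrand has_bochner_integral_integral_eq[OF has_bochner_integral_integrand[OF assms]]
  by (simp add: mult_exp_exp mult.assoc[symmetric])

lemma rem_bound: "\<bar>rem y t\<bar> \<le> K * y powr (b - 1) * exp (\<Lambda> b * t)"
  using mult_left_mono[OF heat_bound[OF profile_measurable profile_bound, of "a * sqrt t" "drift y t"], of "y powr (b - 1) * exp (\<Lambda> b * t)"]
  by (simp add: rem_def abs_mult mult_ac)

lemma rem_has_derivative:
  assumes y: "0 < y" and t: "0 < t"
  shows "((\<lambda>y. rem y t) has_real_derivative rem_deriv y t) (at y)"
proof -
  have c: "a * sqrt t \<noteq> 0" using a_nonzero t by simp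
  have "((\<lambda>y. drift y t) has_real_derivative 1 / y) (at y)"
    unfolding drift_def using y by (auto intro!: derivative_eq_intros)
  note heat = DERIV_chain2[OF heat_has_derivative[OF profile_measurable profile_bound c] this]
  from DERIV_mult[OF DERIV_cmult_right[OF has_real_derivative_powr[OF y, of "b - 1"], of "exp (\<Lambda> b * t)"] heat]
  show ?thesis
    unfolding rem_def by (rule back_subst[where P = "\<lambda>D. (_ has_real_derivative D) _"])
      (use y in \<open>simp add: rem_deriv_def powr_diff power2_eq_square field_simps\<close>)
qed

text \<open>One time majorant for both \<open>rem\<close> and \<open>rem_deriv\<close>: the 1 covers
  the semigroup itself, the second summand its derivative.\<close>

definition kernel_bound :: "real \<Rightarrow> real" where
  "kernel_bound t = exp (\<Lambda> b * t) * (1 + gauss_moment / (\<bar>a\<bar> * sqrt t))"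

lemma kernel_bound_nonneg: "0 \<le> t \<Longrightarrow> 0 \<le> kernel_bound t"
  using gauss_moment_nonneg by (simp add: kernel_bound_def)

lemma rem_deriv_bound:
  assumes y: "0 < y" and t: "0 < t"
  shows "\<bar>rem_deriv y t\<bar> \<le> K * (y powr (b - 1) / y) * kernel_bound t"
proof -
  have c: "a * sqrt t \<noteq> 0" using a_nonzero t by simp
  have "\<bar>(b - 1) * heat profile (a * sqrt t) (drift y t)\<bar> \<le> 1 * K"
    unfolding abs_mult using b
    by (intro mult_mono heat_bound[OF profile_measurable profile_bound]) auto
  moreover have "\<bar>heat_deriv profile (a * sqrt t) (drift y t)\<bar> \<le> K * gauss_moment / \<bar>a * sqrt t\<bar>"
    by (rule heat_deriv_bound[OF profile_measurable profile_bound c])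
  ultimately have "\<bar>(b - 1) * heat profile (a * sqrt t) (drift y t) + heat_deriv profile (a * sqrt t) (drift y t)\<bar>
      \<le> 1 * K + K * gauss_moment / \<bar>a * sqrt t\<bar>"
    by linarith
  also have "\<dots> = K * (1 + gauss_moment / (\<bar>a\<bar> * sqrt t))"
    using t by (simp add: abs_mult distrib_left)
  finally have "\<bar>(b - 1) * heat profile (a * sqrt t) (drift y t) + heat_deriv profile (a * sqrt t) (drift y t)\<bar>
      \<le> K * (1 + gauss_moment / (\<bar>a\<bar> * sqrt t))" .
  from mult_left_mono[OF this, of "y powr (b - 1) / y * exp (\<Lambda> b * t)"]
  show ?thesis using y by (simp add: rem_deriv_def kernel_bound_def abs_mult mult_ac)
qed

lemma rem_measurable [measurable]: "(\<lambda>t. rem y t) \<in> borel_measurable borel"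
  and rem_deriv_measurable [measurable]: "(\<lambda>t. rem_deriv y t) \<in> borel_measurable borel"
proof -
  have "(\<lambda>t. (a * sqrt t, drift y t)) \<in> borel \<rightarrow>\<^sub>M borel \<Otimes>\<^sub>M borel"
    unfolding drift_def by measurable
  from measurable_compose[OF this heat_measurable[OF profile_measurable profile_bound]]
    measurable_compose[OF this heat_deriv_measurable[OF profile_measurable profile_bound]]
  have [measurable]: "(\<lambda>t. heat profile (a * sqrt t) (drift y t)) \<in> borel_measurable borel"
    "(\<lambda>t. heat_deriv profile (a * sqrt t) (drift y t)) \<in> borel_measurable borel" by simp_all
  show "(\<lambda>t. rem y t) \<in> borel_measurable borel" "(\<lambda>t. rem_deriv y t) \<in> borel_measurable borel"
    unfolding rem_def rem_deriv_def by measurable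
qed

end

subsection \<open>Time integrals and strict monotonicity\<close>

text \<open>The Gamma integral. Taking norms makes the complex integrand real, and Borel
  measurability replaces the completed measure by \<open>lborel\<close>.\<close>

lemma set_integrable_powr_exp:
  fixes z k :: real
  assumes "0 < z" "0 < k"
  shows "set_integrable lborel {0<..} (\<lambda>t. t powr (z - 1) * exp (- k * t))"
proof -
  have "set_integrable lebesgue {0<..} (\<lambda>t. norm (complex_of_real t powr (complex_of_real z - 1) / of_real (exp (k * t))))"
    using absolutely_integrable_Gamma_integral[of "complex_of_real z" k] assms
    by (intro set_integrable_norm) auto
  also have "?this \<longleftrightarrow> set_integrable lebesgue {0<..} (\<lambda>t. t powr (z - 1) * exp (- k * t))"
    by (intro set_integrable_cong) (auto simp: norm_divide norm_powr_real_powr exp_minus field_simps)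
  finally show ?thesis
    unfolding set_integrable_def by (subst (asm) integrable_completion) measurable
qed

lemma exp_quot_integral:
  assumes "0 \<le> t"
  shows "set_integrable lborel {0..t} (\<lambda>s. exp (l * s))" and "(LBINT s:{0..t}. exp (l * s)) = exp_quot l t"
proof -
  define F where "F s = (if l = 0 then s else exp (l * s) / l)" for s
  have "(F has_real_derivative exp (l * s)) (at s)" for s
    unfolding F_def by (cases "l = 0") (auto intro!: derivative_eq_intros)
  then have "has_bochner_integral lborel (\<lambda>s. exp (l * s) * indicator {0..t} s) (F t - F 0)"
    using assms by (intro has_bochner_integral_FTC_Icc_real) auto
  moreover have "F t - F 0 = exp_quot l t" by (simp add: F_def exp_quot_def diff_divide_distrib)
  ultimately show "set_integrable lborel {0..t} (\<lambda>s. exp (l * s))" "(LBINT s:{0..t}. exp (l * s)) = exp_quot l t"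
    by (simp_all add: has_bochner_integral_iff set_integrable_def set_lebesgue_integral_def mult.commute)
qed

context dual_asymptotics
begin

lemma set_integrable_kernel_bound: "set_integrable lborel {0<..} kernel_bound"
proof -
  \<comment> \<open>Two Gamma integrands, with parameters 1 and 1/2 and rate
    -\<open>\<Lambda> b\<close> > 0.\<close>
  have "set_integrable lborel {0<..} (\<lambda>t. t powr (1 - 1) * exp (- (- \<Lambda> b) * t) +
      gauss_moment / \<bar>a\<bar> * (t powr (1 / 2 - 1) * exp (- (- \<Lambda> b) * t)))"
    using lambda_neg[of b] b
    by (intro set_integral_add(1)[OF set_integrable_powr_exp set_integrable_mult_right[OF set_integrable_powr_exp]]) auto
  also have "?this \<longleftrightarrow> ?thesis"
  proof (rule set_integrable_cong)
    fix t :: real assume "t \<in> {0<..}"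
    then have p: "t powr (1 / 2 - 1) = 1 / sqrt t" 

      using powr_half_sqrt[of t] powr_minus[of t "1 / 2"] by (simp add: inverse_eq_divide)
    from \<open>t \<in> {0<..}\<close> show "t powr (1 - 1) * exp (- (- \<Lambda> b) * t) +
      gauss_moment / \<bar>a\<bar> * (t powr (1 / 2 - 1) * exp (- (- \<Lambda> b) * t)) = kernel_bound t"
      unfolding p by (simp add: kernel_bound_def field_simps)
  qed auto
  finally show ?thesis .
qed

definition total_bound :: real where
  "total_bound = (LBINT t:{0<..}. kernel_bound t)"

lemma total_bound_nonneg: "0 \<le> total_bound"
  unfolding total_bound_def set_lebesgue_integral_def
  by (intro integral_nonneg_AE AE_I2) (auto simp: indicator_def kernel_bound_nonneg)

text \<open>Enlarging [0, t] to all positive times makes the bound independent of t. Time 0 is left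
  out of the hypothesis: division by zero gives \<open>kernel_bound 0 = 1\<close>, which is no bound
  for the singular derivative.\<close>

lemma time_integral:
  assumes [measurable]: "g \<in> borel_measurable borel" and g: "\<And>\<tau>. 0 < \<tau> \<Longrightarrow> \<bar>g \<tau>\<bar> \<le> c * kernel_bound \<tau>"
    and c: "0 \<le> c"
  shows "set_integrable lborel {0..t} g" and "\<bar>LBINT \<tau>:{0..t}. g \<tau>\<bar> \<le> c * total_bound"
proof -
  have W: "integrable lborel (\<lambda>\<tau>. c * (indicator {0<..} \<tau> *\<^sub>R kernel_bound \<tau>))"
    using set_integrable_kernel_bound unfolding set_integrable_def by simp
  have bd: "AE \<tau> in lborel. \<bar>indicator {0..t} \<tau> *\<^sub>R g \<tau>\<bar> \<le> c * (indicator {0<..} \<tau> *\<^sub>R kernel_bound \<tau>)"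
    using AE_lborel_singleton[of 0]
  proof eventually_elim
    case (elim \<tau>)
    then show ?case using g[of \<tau>] c kernel_bound_nonneg[of \<tau>] by (auto simp: indicator_def abs_mult)
  qed
  show int: "set_integrable lborel {0..t} g"
    unfolding set_integrable_def
  proof (rule Bochner_Integration.integrable_bound[OF W])
    show "AE \<tau> in lborel. norm (indicator {0..t} \<tau> *\<^sub>R g \<tau>) \<le> norm (c * (indicator {0<..} \<tau> *\<^sub>R kernel_bound \<tau>))"
      using bd by eventually_elim simp
  qed measurable
  have "\<bar>LBINT \<tau>:{0..t}. g \<tau>\<bar> \<le> (LBINT \<tau>. \<bar>indicator {0..t} \<tau> *\<^sub>R g \<tau>\<bar>)"
    unfolding set_lebesgue_integral_def by (rule integral_abs_bound)
  also have "\<dots> \<le> (LBINT \<tau>. c * (indicator {0<..} \<tau> *\<^sub>R kernel_bound \<tau>))"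
    using int W bd unfolding set_integrable_def by (intro integral_mono_AE integrable_abs)
  also have "\<dots> = c * total_bound"
    by (simp add: total_bound_def set_lebesgue_integral_def)
  finally show "\<bar>LBINT \<tau>:{0..t}. g \<tau>\<bar> \<le> c * total_bound" .
qed

definition rem_int :: "real \<Rightarrow> real \<Rightarrow> real" where
  "rem_int y t = (LBINT \<tau>:{0..t}. rem y \<tau>)"

definition rem_int_deriv :: "real \<Rightarrow> real \<Rightarrow> real" where
  "rem_int_deriv y t = (LBINT \<tau>:{0..t}. rem_deriv y \<tau>)"

lemma rem_le_kernel:
  assumes "0 < \<tau>"
  shows "\<bar>rem y \<tau>\<bar> \<le> K * y powr (b - 1) * kernel_bound \<tau>"
proof -
  have "K * y powr (b - 1) * (exp (\<Lambda> b * \<tau>) * 1) \<le> K * y powr (b - 1) * kernel_bound \<tau>"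
    unfolding kernel_bound_def using assms gauss_moment_nonneg K_nonneg by (intro mult_left_mono) auto
  then show ?thesis using rem_bound[of y \<tau>] by simp
qed

lemma set_integrable_rem: "set_integrable lborel {0..t} (rem y)"
  using time_integral(1)[OF rem_measurable rem_le_kernel] K_nonneg by simp

lemma rem_int_bound: "\<bar>rem_int y t\<bar> \<le> K * y powr (b - 1) * total_bound"
  unfolding rem_int_def using time_integral(2)[OF rem_measurable rem_le_kernel] K_nonneg by simp

lemma rem_int_deriv_bound:
  assumes "0 < y"
  shows "\<bar>rem_int_deriv y t\<bar> \<le> K * (y powr (b - 1) / y) * total_bound"
  unfolding rem_int_deriv_def using time_integral(2)[OF rem_deriv_measurable rem_deriv_bound[OF assms]] K_nonneg assms
  by simp

lemma rem_int_has_derivative: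
  assumes y: "0 < y"
  shows "((\<lambda>y. rem_int y t) has_real_derivative rem_int_deriv y t) (at y)"
  unfolding rem_int_def rem_int_deriv_def set_lebesgue_integral_def
\<comment> \<open>For |x - y| < y/2 the decreasing factor \<open>x powr (b - 2)\<close> is at most
  its value at y/2, so one multiple of \<open>kernel_bound\<close> dominates on the whole
  window.\<close>
proof (rule has_real_derivative_lebesgue_integral[where e = "y / 2"
    and f' = "\<lambda>y \<tau>. indicator {0..t} \<tau> *\<^sub>R rem_deriv y \<tau>"
    and g = "\<lambda>\<tau>. K * (y / 2) powr (b - 2) * (indicator {0<..} \<tau> *\<^sub>R kernel_bound \<tau>)"])
  show "integrable lborel (\<lambda>\<tau>. indicator {0..t} \<tau> *\<^sub>R rem x \<tau>)" for x
    using set_integrable_rem unfolding set_integrable_def .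
  show "integrable lborel (\<lambda>\<tau>. K * (y / 2) powr (b - 2) * (indicator {0<..} \<tau> *\<^sub>R kernel_bound \<tau>))"
    using set_integrable_kernel_bound unfolding set_integrable_def by simp
  have near: "0 < x" "y / 2 \<le> x" if "\<bar>x - y\<bar> < y / 2" for x using that y by (auto simp: abs_if split: if_splits)
  show "AE \<tau> in lborel. \<forall>x. \<bar>x - y\<bar> < y / 2 \<longrightarrow>
      ((\<lambda>x. indicator {0..t} \<tau> *\<^sub>R rem x \<tau>) has_real_derivative indicator {0..t} \<tau> *\<^sub>R rem_deriv x \<tau>) (at x)"
    \<comment> \<open>At time 0 nothing has been smoothed yet and the remainder need not be
      differentiable in y, hence the null set.\<close>
    using AE_lborel_singleton[of 0]
  proof eventually_elim
    case (elim \<tau>)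
    then show ?case using near by (auto simp: indicator_def intro!: rem_has_derivative)
  qed
  show "AE \<tau> in lborel. \<forall>x. \<bar>x - y\<bar> < y / 2 \<longrightarrow> \<bar>indicator {0..t} \<tau> *\<^sub>R rem_deriv x \<tau>\<bar>
      \<le> K * (y / 2) powr (b - 2) * (indicator {0<..} \<tau> *\<^sub>R kernel_bound \<tau>)"
    using AE_lborel_singleton[of 0]
  proof eventually_elim
    case (elim \<tau>)
    show ?case
    proof (intro allI impI)
      fix x assume x: "\<bar>x - y\<bar> < y / 2"
      show "\<bar>indicator {0..t} \<tau> *\<^sub>R rem_deriv x \<tau>\<bar> \<le> K * (y / 2) powr (b - 2) * (indicator {0<..} \<tau> *\<^sub>R kernel_bound \<tau>)"
      proof (cases "\<tau> \<in> {0<..t}")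
        case True
        have "x powr (b - 1) / x = x powr (b - 2)" using near[OF x] by (simp add: powr_diff power2_eq_square)
        also have "\<dots> \<le> (y / 2) powr (b - 2)" using near[OF x] y b by (intro powr_mono2') auto
        finally have "K * (x powr (b - 1) / x) * kernel_bound \<tau> \<le> K * (y / 2) powr (b - 2) * kernel_bound \<tau>"
          using True K_nonneg by (intro mult_right_mono mult_left_mono kernel_bound_nonneg) auto
        then show ?thesis using rem_deriv_bound[of x \<tau>] near[OF x] True by (auto simp: indicator_def)
      next
        case False
        then show ?thesis using elim K_nonneg kernel_bound_nonneg[of \<tau>] by (auto simp: indicator_def)
      qed
    qed
  qed
qed (use y in auto)

lemma dual_marginal_time_integral:
  assumes y: "0 < y" and t: "0 \<le> t"
  shows "set_integrable lborel {0..t} (dual_marginal r \<delta> \<theta> V y)"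
    and "(LBINT \<tau>:{0..t}. dual_marginal r \<delta> \<theta> V y \<tau>) = y powr (q - 1) * exp_quot (\<Lambda> q) t + rem_int y t"
proof -
  have int: "set_integrable lborel {0..t} (\<lambda>\<tau>. y powr (q - 1) * exp (\<Lambda> q * \<tau>))"
    using exp_quot_integral(1)[OF t] by (rule set_integrable_mult_right)
  have "set_integrable lborel {0..t} (\<lambda>\<tau>. y powr (q - 1) * exp (\<Lambda> q * \<tau>) + rem y \<tau>)"
    by (rule set_integral_add(1)[OF int set_integrable_rem])
  also have "?this \<longleftrightarrow> set_integrable lborel {0..t} (dual_marginal r \<delta> \<theta> V y)"
    using y by (intro set_integrable_cong) (auto simp: dual_marginal_eq)
  finally show "set_integrable lborel {0..t} (dual_marginal r \<delta> \<theta> V y)" .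
  have "(LBINT \<tau>:{0..t}. dual_marginal r \<delta> \<theta> V y \<tau>) = (LBINT \<tau>:{0..t}. y powr (q - 1) * exp (\<Lambda> q * \<tau>) + rem y \<tau>)"
    using y by (intro set_lebesgue_integral_cong) (auto simp: dual_marginal_eq)
  also have "\<dots> = y powr (q - 1) * exp_quot (\<Lambda> q) t + rem_int y t"
    by (simp add: set_integral_add(2)[OF int set_integrable_rem] exp_quot_integral(2)[OF t] rem_int_def)
  finally show "(LBINT \<tau>:{0..t}. dual_marginal r \<delta> \<theta> V y \<tau>) = y powr (q - 1) * exp_quot (\<Lambda> q) t + rem_int y t" .
qed

lemma integrand_antimono:
  assumes "0 < y" "y \<le> y'"
  shows "integrand y' t u \<le> integrand y t u"
  unfolding integrand_def using assms by (intro mult_left_mono antimono) auto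

lemma dual_marginal_antimono:
  assumes y: "0 < y" "y \<le> y'" and t: "0 \<le> t"
  shows "dual_marginal r \<delta> \<theta> V y' t \<le> dual_marginal r \<delta> \<theta> V y t"
  unfolding dual_marginal_integrand
  using has_bochner_integral_integrand[OF _ t] y
  by (intro mult_left_mono integral_mono integrand_antimono[OF y]) (auto simp: has_bochner_integral_iff)

lemma dual_marginal_time_integral_antimono:
  assumes y: "0 < y" "y \<le> y'" and t: "0 \<le> t"
  shows "(LBINT \<tau>:{0..t}. dual_marginal r \<delta> \<theta> V y' \<tau>) \<le> (LBINT \<tau>:{0..t}. dual_marginal r \<delta> \<theta> V y \<tau>)"
  using y t by (intro set_integral_mono dual_marginal_time_integral(1) dual_marginal_antimono) auto

text \<open>Near the origin the pure power distinguishes y w from y' w by a multiple of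
  \<open>w powr (q - 1)\<close>, while the errors are only of order \<open>w powr (b - 1)\<close>;
  for small w the difference survives.\<close>

lemma not_scale_invariant:
  assumes y: "0 < y" "y < y'" and q1: "q < 1"
  obtains w where "0 < w" "\<bar>deriv V (y' * w)\<bar> \<noteq> \<bar>deriv V (y * w)\<bar>"
proof -
  define d where "d = y powr (q - 1) - y' powr (q - 1)"
  define S where "S = K * (y powr (b - 1) + y' powr (b - 1)) + 1"
  have d: "0 < d" using y q1 powr_less_mono2_neg[of "q - 1" y y'] by (simp add: d_def)
  have S: "0 < S" using K_nonneg by (simp add: S_def add_nonneg_pos)
  \<comment> \<open>Chosen so that \<open>S * w powr (b - q)\<close> is half of \<open>d\<close>.
    The 1 added in \<open>S\<close> keeps it positive when K = 0.\<close>
  define w where "w = (d / (2 * S)) powr (1 / (b - q))"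
  have w: "0 < w" using d S by (simp add: w_def)
  have "w powr (b - q) = d / (2 * S)" using q d S by (simp add: w_def powr_powr)
  then have Sw: "S * w powr (b - q) < d" using d S by (simp add: field_simps)
  have "\<bar>deriv V (y' * w)\<bar> \<noteq> \<bar>deriv V (y * w)\<bar>"
  proof
    assume "\<bar>deriv V (y' * w)\<bar> = \<bar>deriv V (y * w)\<bar>"
    then have "(y * w) powr (q - 1) - (y' * w) powr (q - 1) \<le> K * (y * w) powr (b - 1) + K * (y' * w) powr (b - 1)"
      using approx[of "y * w"] approx[of "y' * w"] y w unfolding abs_le_iff by (simp add: algebra_simps)
    then have "d * w powr (q - 1) \<le> K * (y powr (b - 1) + y' powr (b - 1)) * w powr (b - 1)"
      using y w by (simp add: d_def powr_mult algebra_simps)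
    also have "\<dots> \<le> S * w powr (b - 1)" by (intro mult_right_mono) (auto simp: S_def)
    also have "w powr (b - 1) = w powr (b - q) * w powr (q - 1)" by (simp add: powr_add[symmetric])
    finally have "d * w powr (q - 1) \<le> S * w powr (b - q) * w powr (q - 1)" by (simp add: mult.assoc)
    then show False using Sw w by simp
  qed
  with w that show ?thesis by blast
qed

text \<open>Monotonicity of |V'| orders the integrands only weakly. They are continuous, and by
  \<open>not_scale_invariant\<close> they differ at some point, hence on a nonempty open set, which
  is not a null set.\<close>

lemma dual_marginal_strict_antimono:
  assumes y: "0 < y" "y < y'" and t: "0 < t" and q1: "q < 1"
  shows "dual_marginal r \<delta> \<theta> V y' t < dual_marginal r \<delta> \<theta> V y t"
proof -
  define G where "G u = integrand y t u - integrand y' t u" for u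
  have int: "integrable lborel (integrand y t)" "integrable lborel (integrand y' t)"
    using has_bochner_integral_integrand y t by (auto simp: has_bochner_integral_iff)
  then have intG: "integrable lborel G" unfolding G_def by simp
  have G: "0 \<le> G u" for u unfolding G_def using integrand_antimono[of y y'] y by simp
  obtain w where w: "0 < w" "\<bar>deriv V (y' * w)\<bar> \<noteq> \<bar>deriv V (y * w)\<bar>"
    using not_scale_invariant[OF y q1] by blast
  have c: "a * sqrt t \<noteq> 0" using a_nonzero t by simp
  have "w = exp (a * sqrt t * (ln w / (a * sqrt t)))" using c w by simp
  then have "G (ln w / (a * sqrt t)) \<noteq> 0"
    using w(2) unfolding G_def integrand_def by (simp flip: right_diff_distrib)
  then have "{u. G u \<noteq> 0} \<noteq> {}" by blast
  moreover have "open {u. G u \<noteq> 0}"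
  proof -
    have "continuous_on UNIV (\<lambda>u. deriv V (z * exp (a * sqrt t * u)))" if "0 < z" for z
      using that by (intro continuous_on_compose2[OF cont]) (auto intro!: continuous_intros)
    then have "continuous_on UNIV G"
      unfolding G_def integrand_def using y by (intro continuous_intros) auto
    then show ?thesis by (intro open_Collect_neq continuous_on_const)
  qed
  ultimately have "\<not> negligible {u. G u \<noteq> 0}" by (intro open_not_negligible)
  then have "{u. G u \<noteq> 0} \<notin> null_sets lborel"
    using negligible_iff_null_sets null_sets_completionI by blast
  have "(LBINT u. G u) \<noteq> 0"
  proof
    assume "(LBINT u. G u) = 0"
    then have "AE u in lborel. G u = 0"
      using integral_nonneg_eq_0_iff_AE[OF intG] G by simp
    moreover have [measurable]: "G \<in> borel_measurable borel" using intG by auto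
    ultimately have "{u. G u \<noteq> 0} \<in> null_sets lborel"
      using AE_iff_null[of lborel "\<lambda>u. G u = 0"] \<open>open {u. G u \<noteq> 0}\<close> by simp
    then show False using \<open>{u. G u \<noteq> 0} \<notin> null_sets lborel\<close> by blast
  qed
  moreover have "0 \<le> (LBINT u. G u)" using G by (intro integral_nonneg_AE) simp
  ultimately have "0 < (LBINT u. G u)" by simp
  then have "(LBINT u. integrand y' t u) < (LBINT u. integrand y t u)"
    unfolding G_def using int by simp
  then show ?thesis unfolding dual_marginal_integrand by (intro mult_strict_left_mono) auto
qed

end

subsection \<open>Dominant balance\<close>

text \<open>For k >= 1 the mean value inequality applies with the derivative at B. For k < 1 that
  derivative blows up at 0 and u has no lower bound, so u is compared with x through v = u/x and
  |v^k - 1| <= |v - 1|. Adding the two constants gives one formula for both cases.\<close>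

lemma abs_powr_diff_le:
  fixes u x k B :: real
  assumes u: "0 < u" "u \<le> B" and x: "0 < x" "x \<le> B" and k: "0 < k"
  shows "\<bar>u powr k - x powr k\<bar> \<le> (k * B powr (k - 1) + x powr (k - 1)) * \<bar>u - x\<bar>"
proof (cases "1 \<le> k")
  case True
  have "norm (u powr k - x powr k) \<le> k * B powr (k - 1) * norm (u - x)"
  proof (rule field_differentiable_bound[where S = "{0<..B}" and f' = "\<lambda>z. k * z powr (k - 1)"])
    show "((\<lambda>z. z powr k) has_real_derivative k * z powr (k - 1)) (at z within {0<..B})" if "z \<in> {0<..B}" for z
      using that by (intro has_field_derivative_at_within[OF has_real_derivative_powr]) auto
    show "norm (k * z powr (k - 1)) \<le> k * B powr (k - 1)" if "z \<in> {0<..B}" for z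
      using that True by (auto simp: abs_mult intro!: mult_left_mono powr_mono2)
  qed (use u x in auto)
  also have "\<dots> \<le> (k * B powr (k - 1) + x powr (k - 1)) * norm (u - x)"
    by (intro mult_right_mono) auto
  finally show ?thesis by simp
next
  case False
  define v where "v = u / x"
  have v: "0 < v" using u x by (simp add: v_def)
  have "\<bar>v powr k - 1\<bar> \<le> \<bar>v - 1\<bar>"
  proof (cases "1 \<le> v")
    case True
    have "1 \<le> v powr k" using True k by (intro ge_one_powr_ge_zero) auto
    moreover have "v powr k \<le> v powr 1" using True False by (intro powr_mono) auto
    ultimately have "1 \<le> v powr k" "v powr k \<le> v powr 1" .
    then show ?thesis using True by simp
  next
    case F: False
    then have "v powr 1 \<le> v powr k" using v False by (intro powr_mono') auto
    moreover have "v powr k \<le> 1" using F v k by (intro powr_le1) auto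
    ultimately have "v powr 1 \<le> v powr k" "v powr k \<le> 1" .
    then show ?thesis using F v by simp
  qed
  then have "x powr k * \<bar>v powr k - 1\<bar> \<le> x powr k * \<bar>v - 1\<bar>" by (intro mult_left_mono) auto
  moreover have "x powr k * \<bar>v powr k - 1\<bar> = \<bar>u powr k - x powr k\<bar>"
  proof -
    have "x powr k * (v powr k - 1) = u powr k - x powr k"
      using u x by (simp add: v_def powr_divide field_simps)
    then show ?thesis by (metis abs_mult abs_of_nonneg powr_ge_zero)
  qed
  moreover have "x powr k * \<bar>v - 1\<bar> = x powr (k - 1) * \<bar>u - x\<bar>"
  proof -
    have "x * (v - 1) = u - x" using x by (simp add: v_def field_simps)
    then have "x * \<bar>v - 1\<bar> = \<bar>u - x\<bar>" using x by (metis abs_mult abs_of_pos)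
    moreover have "x powr k = x powr (k - 1) * x" using x by (simp add: powr_diff)
    ultimately show ?thesis by simp
  qed
  ultimately have "\<bar>u powr k - x powr k\<bar> \<le> x powr (k - 1) * \<bar>u - x\<bar>" by simp
  also have "\<dots> \<le> (k * B powr (k - 1) + x powr (k - 1)) * \<bar>u - x\<bar>"
    using k by (intro mult_right_mono) auto
  finally show ?thesis .
qed

text \<open>
  Measuring \<open>y\<close> in units of \<open>S powr (\<kappa> / (1 - m))\<close> makes the leading term scale free, so the equation
  bounds the rescaled \<open>y\<close> away from zero, uniformly in \<open>S\<close>.
\<close>

lemma dominant_balance:
  fixes m M b \<gamma> \<Gamma> \<kappa> \<kappa>' K :: real
  assumes m: "m < b" and M: "M < 1" and b: "b < 1" and \<gamma>: "0 < \<gamma>" and \<Gamma>: "0 \<le> \<Gamma>" and K: "0 \<le> K"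
    and \<kappa>: "0 < \<kappa>" and gap: "\<kappa>' / (1 - M) < \<kappa> / (1 - m)"
  obtains c d D where "0 < c" "\<And>x. 0 < x \<Longrightarrow> 0 < d x" "\<And>x. d x \<le> 1"
    "\<And>x y S G g E. 0 < x \<Longrightarrow> 0 < y \<Longrightarrow> 1 \<le> S \<Longrightarrow> \<gamma> * S powr \<kappa> \<le> G \<Longrightarrow> 0 \<le> g \<Longrightarrow> g \<le> \<Gamma> * S powr \<kappa>' \<Longrightarrow>
      \<bar>E\<bar> \<le> K * y powr (b - 1) \<Longrightarrow> y powr (m - 1) * G + y powr (M - 1) * g + E = x \<Longrightarrow>
      d x * S powr (\<kappa> / (1 - m)) \<le> y \<and> y powr (b - 1) \<le> D x * S powr (- c) \<and> y powr (M - 1) * g \<le> D x * S powr (- c)"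
proof -
  define k where "k = \<kappa> / (1 - m)"
  have k: "0 < k" using \<kappa> m b by (simp add: k_def)
  have kk: "k * (1 - m) = \<kappa>" using m b by (simp add: k_def)
  \<comment> \<open>For s = y / S^k below 1, multiplying the balance by
    \<open>s powr (1 - m)\<close> yields \<gamma> <= (x + K) \<open>s powr (b - m)\<close>; solving
    for s gives this value, and the cap 1 covers s >= 1.\<close>
  define d where "d x = min 1 ((\<gamma> / (x + K)) powr (1 / (b - m)))" for x
  \<comment> \<open>With y at least \<open>d x * S powr k\<close>, the error carries the S-exponent
    -k (1 - b) and the subdominant term \<kappa>' - k (1 - M). Both are negative, the latter by
    \<open>gap\<close>.\<close>
  define c where "c = min (k * (1 - b)) (k * (1 - M) - \<kappa>')"
  define D where "D x = d x powr (b - 1) + \<Gamma> * d x powr (M - 1)" for x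
  have "\<kappa>' < k * (1 - M)" using gap M by (simp add: k_def[symmetric] pos_divide_less_eq)
  then have c: "0 < c" using k b by (simp add: c_def)
  have d: "0 < d x" if "0 < x" for x using that \<gamma> K by (simp add: d_def add_pos_nonneg)
  have "d x * S powr k \<le> y \<and> y powr (b - 1) \<le> D x * S powr (- c) \<and> y powr (M - 1) * g \<le> D x * S powr (- c)"
    if x: "0 < x" and y: "0 < y" and S: "1 \<le> S" and G: "\<gamma> * S powr \<kappa> \<le> G" and g: "0 \<le> g" "g \<le> \<Gamma> * S powr \<kappa>'"
      and E: "\<bar>E\<bar> \<le> K * y powr (b - 1)" and eq: "y powr (m - 1) * G + y powr (M - 1) * g + E = x"
    for x y S G g E
  proof -
    define s where "s = y / S powr k"
    have s: "0 < s" and ys: "y = s * S powr k" using y S by (simp_all add: s_def)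
    have pw: "y powr p = s powr p * S powr (k * p)" for p
      using s S by (simp add: ys powr_mult powr_powr)
    have "\<gamma> * s powr (m - 1) = y powr (m - 1) * (\<gamma> * S powr \<kappa>)"
    proof -
      have "S powr (k * (m - 1)) * S powr \<kappa> = 1"
        using S kk by (simp add: powr_add[symmetric] algebra_simps)
      then show ?thesis by (simp add: pw)
    qed
    also have "\<dots> \<le> y powr (m - 1) * G" using G by (intro mult_left_mono) auto
    also have "\<dots> \<le> x + K * y powr (b - 1)"
    proof -
      have "0 \<le> y powr (M - 1) * g" using g by simp
      then show ?thesis using eq E by linarith
    qed
    \<comment> \<open>As S >= 1 and b < 1, rescaling can only shrink the error, and S drops out of
      the inequality for s.\<close>
    also have "\<dots> \<le> x + K * s powr (b - 1)"
    proof -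
      have "S powr (k * (b - 1)) \<le> S powr 0" using S k b by (intro powr_mono) (auto simp: mult_nonneg_nonpos)
      then have "y powr (b - 1) \<le> s powr (b - 1)" using S by (simp add: pw mult_left_le)
      then show ?thesis using K by (simp add: mult_left_mono)
    qed
    finally have main: "\<gamma> * s powr (m - 1) \<le> x + K * s powr (b - 1)" .
    have ds: "d x \<le> s"
    proof (cases "1 \<le> s")
      case False
      have "\<gamma> * s powr (m - 1) * s powr (1 - m) \<le> (x + K * s powr (b - 1)) * s powr (1 - m)"
        using main by (intro mult_right_mono) auto
      then have "\<gamma> \<le> x * s powr (1 - m) + K * s powr (b - m)"
        using s by (simp add: distrib_right mult.assoc powr_add[symmetric])
      also have "\<dots> \<le> x * s powr (b - m) + K * s powr (b - m)"
        using False s b x K by (intro add_mono mult_left_mono powr_mono') auto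
      finally have "\<gamma> / (x + K) \<le> s powr (b - m)" using x K by (simp add: pos_divide_le_eq algebra_simps)
      then have "(\<gamma> / (x + K)) powr (1 / (b - m)) \<le> (s powr (b - m)) powr (1 / (b - m))"
        using \<gamma> x K m by (intro powr_mono2) auto
      also have "\<dots> = s" using s m by (simp add: powr_powr)
      finally show ?thesis by (simp add: d_def)
    qed (simp add: d_def)
    have Sc: "S powr e \<le> S powr (- c)" if "e \<le> - c" for e using S that by (intro powr_mono) auto
    have dD: "0 \<le> \<Gamma> * d x powr (M - 1)" "0 \<le> d x powr (b - 1)" using \<Gamma> by auto
    have "y powr (b - 1) \<le> d x powr (b - 1) * S powr (- c)"
      unfolding pw using ds d[OF x] b
      by (intro mult_mono Sc powr_mono2') (auto simp: c_def algebra_simps)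
    also have "\<dots> \<le> D x * S powr (- c)" using dD by (intro mult_right_mono) (auto simp: D_def)
    finally have 1: "y powr (b - 1) \<le> D x * S powr (- c)" .
    have "y powr (M - 1) * g \<le> s powr (M - 1) * S powr (k * (M - 1)) * (\<Gamma> * S powr \<kappa>')"
      unfolding pw using g by (intro mult_left_mono) auto
    also have "\<dots> = \<Gamma> * s powr (M - 1) * S powr (k * (M - 1) + \<kappa>')" by (simp add: powr_add mult_ac)
    also have "\<dots> \<le> \<Gamma> * d x powr (M - 1) * S powr (- c)"
      using ds d[OF x] M \<Gamma>
      by (intro mult_mono mult_left_mono Sc powr_mono2') (auto simp: c_def algebra_simps min_def)
    also have "\<dots> \<le> D x * S powr (- c)" using dD by (intro mult_right_mono) (auto simp: D_def)
    finally have 2: "y powr (M - 1) * g \<le> D x * S powr (- c)" .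
    have "d x * S powr k \<le> y" unfolding ys using ds by (intro mult_right_mono) auto
    with 1 2 show ?thesis by blast
  qed
  moreover have "d x \<le> 1" for x by (simp add: d_def)
  ultimately show ?thesis using that[of c d D] c d unfolding k_def by blast
qed

text \<open>A common form of both rates: S = \<open>exp\<close> gives exponential and S = identity
  gives polynomial convergence, with the threshold time fixed at 1.\<close>

definition converges_at_scale :: "(real \<Rightarrow> real) \<Rightarrow> (real \<Rightarrow> real \<Rightarrow> real) \<Rightarrow> (real \<Rightarrow> real) \<Rightarrow> bool" where
  "converges_at_scale S f g \<longleftrightarrow>
    (\<exists>c>0. \<exists>D. \<forall>x>0. \<forall>t\<ge>1. \<bar>f x t - g x\<bar> \<le> D x * S t powr (- c))"

lemma converges_at_scale_exp: "converges_at_scale exp f g \<Longrightarrow> converges_exponentially f g"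
  unfolding converges_at_scale_def converges_exponentially_def
  by (metis exp_powr_real mult.commute zero_less_one)

lemma converges_at_scale_id: "converges_at_scale (\<lambda>t. t) f g \<Longrightarrow> converges_polynomially f g"
  unfolding converges_at_scale_def converges_polynomially_def by (metis zero_less_one)

section \<open>Wealth as a function of the dual variable, and its inversion\<close>

locale two_duals = market +
  fixes V1 V2 :: "real \<Rightarrow> real" and q1 q2 b K1 K2 :: real
  assumes A1: "dual_asymptotics r \<delta> \<theta> V1 q1 b K1" and A2: "dual_asymptotics r \<delta> \<theta> V2 q2 b K2"
begin

sublocale D1: dual_asymptotics r \<delta> \<theta> V1 q1 b K1 by (rule A1)
sublocale D2: dual_asymptotics r \<delta> \<theta> V2 q2 b K2 by (rule A2)

lemma q1: "q1 < 1" and q2: "q2 < 1"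
  using D1.q D2.q D1.b by auto

definition wealth :: "real \<Rightarrow> real \<Rightarrow> real" where
  "wealth y t = - dual_value_y r \<delta> \<theta> V1 V2 y t"

definition err :: "real \<Rightarrow> real \<Rightarrow> real" where
  "err y t = D1.rem y t + D2.rem_int y t"

definition err_deriv :: "real \<Rightarrow> real \<Rightarrow> real" where
  "err_deriv y t = D1.rem_deriv y t + D2.rem_int_deriv y t"

text \<open>Valid for t >= 1: the terminal part has the singular factor \<open>1 / sqrt t\<close>,
  bounded only away from 0, while the running part is already integrated over time.\<close>

definition err_const :: real where
  "err_const = K1 * (1 + gauss_moment / \<bar>a\<bar>) + K2 * D2.total_bound"

lemma err_const_nonneg: "0 \<le> err_const"
  unfolding err_const_def using D1.K_nonneg D2.K_nonneg gauss_moment_nonneg D2.total_bound_nonneg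
  by (intro add_nonneg_nonneg mult_nonneg_nonneg divide_nonneg_nonneg) auto

lemma wealth_eq:
  assumes "0 < y" "0 \<le> t"
  shows "wealth y t = y powr (q1 - 1) * exp (\<Lambda> q1 * t) + y powr (q2 - 1) * exp_quot (\<Lambda> q2) t + err y t"
  unfolding wealth_def dual_value_y_def err_def
  using D1.dual_marginal_eq[OF assms] D2.dual_marginal_time_integral(2)[OF assms] by simp

lemma kernel_bound_late:
  assumes "1 \<le> t"
  shows "D1.kernel_bound t \<le> 1 + gauss_moment / \<bar>a\<bar>"
proof -
  have "\<bar>a\<bar> * 1 \<le> \<bar>a\<bar> * sqrt t" using assms by (intro mult_left_mono) auto
  then have "gauss_moment / (\<bar>a\<bar> * sqrt t) \<le> gauss_moment / \<bar>a\<bar>"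
    using gauss_moment_nonneg a_nonzero by (intro divide_left_mono) auto
  moreover have "exp (\<Lambda> b * t) \<le> 1" using lambda_neg[of b] D1.b assms by (simp add: mult_nonpos_nonneg)
  ultimately have "exp (\<Lambda> b * t) * (1 + gauss_moment / (\<bar>a\<bar> * sqrt t)) \<le> 1 * (1 + gauss_moment / \<bar>a\<bar>)"
    using gauss_moment_nonneg assms by (intro mult_mono) auto
  then show ?thesis by (simp add: D1.kernel_bound_def)
qed

lemma err_bound:
  assumes "1 \<le> t"
  shows "\<bar>err y t\<bar> \<le> err_const * y powr (b - 1)"
proof -
  have "\<bar>D1.rem y t\<bar> \<le> K1 * y powr (b - 1) * D1.kernel_bound t"
    using assms by (intro D1.rem_le_kernel) simp
  also have "\<dots> \<le> K1 * y powr (b - 1) * (1 + gauss_moment / \<bar>a\<bar>)"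
    using kernel_bound_late[OF assms] D1.K_nonneg by (intro mult_left_mono) auto
  finally have "\<bar>D1.rem y t\<bar> \<le> K1 * y powr (b - 1) * (1 + gauss_moment / \<bar>a\<bar>)" .
  with D2.rem_int_bound[of y t] show ?thesis
    unfolding err_def err_const_def by (simp add: algebra_simps)
qed

lemma err_deriv_bound:
  assumes y: "0 < y" and t: "1 \<le> t"
  shows "\<bar>y * err_deriv y t\<bar> \<le> err_const * y powr (b - 1)"
proof -
  define P where "P = y powr (b - 1) / y"
  have "\<bar>D1.rem_deriv y t\<bar> \<le> K1 * (y powr (b - 1) / y) * D1.kernel_bound t"
    using t by (intro D1.rem_deriv_bound y) simp
  also have "\<dots> \<le> K1 * (y powr (b - 1) / y) * (1 + gauss_moment / \<bar>a\<bar>)"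
    using kernel_bound_late[OF t] D1.K_nonneg y by (intro mult_left_mono) auto
  finally have "\<bar>err_deriv y t\<bar> \<le> K1 * (y powr (b - 1) / y) * (1 + gauss_moment / \<bar>a\<bar>)
      + K2 * (y powr (b - 1) / y) * D2.total_bound"
    using D2.rem_int_deriv_bound[OF y, of t] unfolding err_deriv_def by linarith
  also have "\<dots> = err_const * (y powr (b - 1) / y)"
    unfolding err_const_def P_def[symmetric] by (simp add: algebra_simps)
  finally have "\<bar>err_deriv y t\<bar> \<le> err_const * (y powr (b - 1) / y)" .
  from mult_left_mono[OF this, of y] y show ?thesis by (simp add: abs_mult)
qed

definition wealth_deriv :: "real \<Rightarrow> real \<Rightarrow> real" where
  "wealth_deriv y t = ((q1 - 1) * y powr (q1 - 1) * exp (\<Lambda> q1 * t) +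
     (q2 - 1) * y powr (q2 - 1) * exp_quot (\<Lambda> q2) t) / y + err_deriv y t"

lemma wealth_has_derivative:
  assumes y: "0 < y" and t: "0 < t"
  shows "((\<lambda>y. wealth y t) has_real_derivative wealth_deriv y t) (at y)"
proof -
  have pw: "((\<lambda>y. y powr p * G) has_real_derivative p * y powr p * G / y) (at y)" for p G
    using DERIV_cmult_right[OF has_real_derivative_powr[OF y, of p], of G] y by (simp add: powr_diff)
  have "((\<lambda>y. y powr (q1 - 1) * exp (\<Lambda> q1 * t) + y powr (q2 - 1) * exp_quot (\<Lambda> q2) t + err y t)
      has_real_derivative wealth_deriv y t) (at y)"
    unfolding wealth_deriv_def err_deriv_def err_def add_divide_distrib
    using y t by (intro DERIV_add pw D1.rem_has_derivative D2.rem_int_has_derivative)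
  moreover have "eventually (\<lambda>z. z \<in> {0<..}) (nhds y)" using y by (intro eventually_nhds_in_open) auto
  then have "eventually (\<lambda>z. wealth z t = z powr (q1 - 1) * exp (\<Lambda> q1 * t) + z powr (q2 - 1) * exp_quot (\<Lambda> q2) t + err z t) (nhds y)"
    by eventually_elim (use t in \<open>auto simp: wealth_eq\<close>)
  ultimately show ?thesis by (subst DERIV_cong_ev[OF refl _ refl]) (auto elim: eventually_mono)
qed

lemma wealth_strict_antimono:
  assumes "0 < y" "y < y'" "0 < t"
  shows "wealth y' t < wealth y t"
  unfolding wealth_def dual_value_y_def
  using D1.dual_marginal_strict_antimono[OF assms q1] D2.dual_marginal_time_integral_antimono[of y y' t] assms
  by simp

lemma exp_quot_nonneg:
  assumes "0 \<le> t"
  shows "0 \<le> exp_quot l t"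
  unfolding exp_quot_integral(2)[OF assms, symmetric] set_lebesgue_integral_def
  by (intro integral_nonneg_AE AE_I2) auto

text \<open>Wealth falls below x for large y, since all exponents are negative, and reaches x at an
  explicit small y. The intermediate value theorem gives existence; strict monotonicity makes the
  definite description well defined.\<close>

lemma dual_point:
  assumes x: "0 < x" and t: "1 \<le> t"
  shows "0 < dual_point r \<delta> \<theta> V1 V2 x t \<and> wealth (dual_point r \<delta> \<theta> V1 V2 x t) t = x"
proof -
  have t0: "0 < t" using t by simp
  have "((\<lambda>y. y powr (q1 - 1) * exp (\<Lambda> q1 * t) + y powr (q2 - 1) * exp_quot (\<Lambda> q2) t + err_const * y powr (b - 1))
      \<longlongrightarrow> 0 * exp (\<Lambda> q1 * t) + 0 * exp_quot (\<Lambda> q2) t + err_const * 0) at_top"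
    using q1 q2 D1.b by (intro tendsto_intros tendsto_neg_powr filterlim_ident) auto
  then have "eventually (\<lambda>y. y powr (q1 - 1) * exp (\<Lambda> q1 * t) + y powr (q2 - 1) * exp_quot (\<Lambda> q2) t + err_const * y powr (b - 1) < x) at_top"
    using x by (intro order_tendstoD(2)) auto
  then obtain y0 where y0: "0 < y0" and "y0 powr (q1 - 1) * exp (\<Lambda> q1 * t) + y0 powr (q2 - 1) * exp_quot (\<Lambda> q2) t + err_const * y0 powr (b - 1) < x"
    using eventually_conj[OF eventually_gt_at_top[of 0]] eventually_happens'[OF trivial_limit_at_top_linorder] by blast
  then have hi: "wealth y0 t < x" using err_bound[OF t, of y0] t0 by (simp add: wealth_eq)
  define G where "G = exp (\<Lambda> q1 * t)"
  have G: "0 < G" by (simp add: G_def)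
  \<comment> \<open>The first entry makes the error at most half of the leading term, the second
    makes the other half at least x. The added 1 avoids division by zero.\<close>
  define y1 where "y1 = min ((G / (2 * (err_const + 1))) powr (1 / (b - q1))) ((2 * x / G) powr (1 / (q1 - 1)))"
  have y1: "0 < y1" using G x err_const_nonneg by (simp add: y1_def)
  have "y1 powr (b - q1) \<le> ((G / (2 * (err_const + 1))) powr (1 / (b - q1))) powr (b - q1)"
    using y1 D1.q by (intro powr_mono2) (auto simp: y1_def)
  then have "y1 powr (b - q1) \<le> G / (2 * (err_const + 1))"
    using D1.q G err_const_nonneg by (simp add: powr_powr)
  then have small: "(err_const + 1) * y1 powr (b - q1) \<le> G / 2" using err_const_nonneg by (simp add: field_simps)
  have "((2 * x / G) powr (1 / (q1 - 1))) powr (q1 - 1) \<le> y1 powr (q1 - 1)"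
    using y1 q1 by (intro powr_mono2') (auto simp: y1_def)
  then have large: "2 * x / G \<le> y1 powr (q1 - 1)" using q1 x G by (simp add: powr_powr)
  have lo: "x \<le> wealth y1 t"
  proof -
    have "x = (2 * x / G) * (G / 2)" using G by simp
    also have "\<dots> \<le> y1 powr (q1 - 1) * (G / 2)" using large G by (intro mult_right_mono) auto
    also have "\<dots> \<le> y1 powr (q1 - 1) * (G - err_const * y1 powr (b - q1))"
    proof (intro mult_left_mono)
      show "G / 2 \<le> G - err_const * y1 powr (b - q1)"
        using small powr_ge_zero[of y1 "b - q1"] unfolding distrib_right by linarith
    qed simp
    also have "\<dots> = y1 powr (q1 - 1) * G - err_const * y1 powr (b - 1)"
      by (simp add: right_diff_distrib powr_add[symmetric] mult.left_commute)
    also have "\<dots> \<le> wealth y1 t"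
    proof -
      have "0 \<le> y1 powr (q2 - 1) * exp_quot (\<Lambda> q2) t" using exp_quot_nonneg t0 by simp
      then show ?thesis using err_bound[OF t, of y1] t0 y1 by (simp add: wealth_eq G_def)
    qed
    finally show ?thesis .
  qed
  have "y1 \<le> y0" using wealth_strict_antimono[OF y0 _ t0, of y1] lo hi by (cases "y0 < y1") auto
  then have "\<exists>y\<ge>y1. y \<le> y0 \<and> wealth y t = x"
  proof (intro IVT2' lo)
    show "wealth y0 t \<le> x" using hi by simp
    show "continuous_on {y1..y0} (\<lambda>y. wealth y t)"
      using y1 t0 by (intro continuous_at_imp_continuous_on ballI DERIV_isCont[OF wealth_has_derivative]) auto
  qed
  then obtain y where y: "0 < y" "wealth y t = x" using y1 less_le_trans by blast
  have "dual_point r \<delta> \<theta> V1 V2 x t = y"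
    unfolding dual_point_def
  proof (rule the_equality)
    show "0 < y \<and> x = - dual_value_y r \<delta> \<theta> V1 V2 y t" using y by (simp add: wealth_def)
    fix z assume z: "0 < z \<and> x = - dual_value_y r \<delta> \<theta> V1 V2 z t"
    then have "wealth z t = x" by (simp add: wealth_def)
    with z y show "z = y"
      using wealth_strict_antimono[of z y t] wealth_strict_antimono[of y z t] t0 by (cases z y rule: linorder_cases) auto
  qed
  with y show ?thesis by simp
qed

end

subsection \<open>Limits along the optimal dual point\<close>

context market
begin

text \<open>After division by 1 - q both q-dependent summands, -(\<theta>^2/2) q and -r/(1 - q), are
  strictly decreasing. The quotient is the exponential growth rate in t of the y that keeps
  \<open>y powr (q - 1) * exp (\<Lambda> q * t)\<close> of order one.\<close>

lemma lambda_slope: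
  assumes "p < q" "q < 1"
  shows "\<Lambda> q / (1 - q) < \<Lambda> p / (1 - p)"
proof -
  have eq: "\<Lambda> q / (1 - q) = - (\<theta>\<^sup>2 / 2) * q - r / (1 - q) + (r - \<delta>)" if "q < 1" for q
    using that unfolding lambda_eq[OF \<theta>] by (simp add: field_simps)
  have "\<theta>\<^sup>2 / 2 * p < \<theta>\<^sup>2 / 2 * q" using assms \<theta> by (intro mult_strict_left_mono) auto
  moreover have "r / (1 - p) < r / (1 - q)" using assms r by (intro divide_strict_left_mono) auto
  ultimately show ?thesis using assms by (simp add: eq)
qed

lemma qstar_neg: "qstar r \<delta> \<theta> < 0"
proof -
  have "sqrt (\<alpha>\<^sup>2) < sqrt (\<alpha>\<^sup>2 + 2 * \<delta> / \<theta>\<^sup>2)" using \<delta> \<theta> by (intro real_sqrt_less_mono) simp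
  then show ?thesis by (simp add: qstar_def)
qed

lemma lambda_qstar: "\<Lambda> (qstar r \<delta> \<theta>) = 0"
proof -
  have sq: "(\<alpha> - qstar r \<delta> \<theta>)\<^sup>2 = \<alpha>\<^sup>2 + 2 * \<delta> / \<theta>\<^sup>2"
    using \<delta> by (simp add: qstar_def)
  have a2: "a\<^sup>2 = \<theta>\<^sup>2 / 2" by (simp add: acoef_def power_divide)
  show ?thesis unfolding lambda_def beta_def sq a2 using \<theta> by (simp add: field_simps)
qed

lemma lambda_pos:
  assumes "q < qstar r \<delta> \<theta>"
  shows "0 < \<Lambda> q"
  using lambda_slope[OF assms] qstar_neg lambda_qstar assms by (simp add: zero_less_divide_iff)

lemma lambda_nonpos:
  assumes "qstar r \<delta> \<theta> \<le> q" "q < 1"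
  shows "\<Lambda> q \<le> 0"
proof (cases "q = qstar r \<delta> \<theta>")
  case False
  then show ?thesis using lambda_slope[of "qstar r \<delta> \<theta>" q] lambda_qstar assms by (simp add: divide_less_0_iff)
qed (simp add: lambda_qstar)

end

text \<open>An integral over an interval of length t is at most t times the maximum of exp(l s),
  attained at s = t or s = 0 according to the sign of l.\<close>

lemma exp_quot_le:
  assumes t: "0 < t"
  shows "exp_quot l t \<le> t * exp (max l 0 * t)"
proof (cases "0 < l")
  case True
  have "1 - l * t \<le> exp (- (l * t))" using exp_ge_add_one_self[of "- (l * t)"] by simp
  then have "(1 - l * t) * exp (l * t) \<le> exp (- (l * t)) * exp (l * t)" by (intro mult_right_mono) auto
  then show ?thesis using True by (simp add: exp_quot_def mult_exp_exp field_simps)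
next
  case False
  show ?thesis
  proof (cases "l = 0")
    case F: False
    have "l * t \<le> exp (l * t) - 1" using exp_ge_add_one_self[of "l * t"] by linarith
    then show ?thesis using False F by (simp add: exp_quot_def divide_le_eq mult.commute)
  qed (simp add: exp_quot_def)
qed

text \<open>The constant is the one that gives equality at t = 1.\<close>

lemma exp_quot_ge:
  assumes "0 < l" "1 \<le> t"
  shows "(1 - exp (- l)) / l * exp (l * t) \<le> exp_quot l t"
proof -
  have "1 \<le> exp (- l) * exp (l * t)" using assms by (simp add: mult_exp_exp)
  then show ?thesis using assms by (simp add: exp_quot_def divide_right_mono algebra_simps)
qed

context two_duals
begin

lemma optimal_amount_eq:
  assumes x: "0 < x" and t: "1 \<le> t" and y: "y = dual_point r \<delta> \<theta> V1 V2 x t"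
  shows "optimal_amount r \<delta> \<theta> \<sigma> V1 V2 x t = \<theta> / \<sigma> * (- (y * wealth_deriv y t))"
proof -
  have "((\<lambda>z. - wealth z t) has_real_derivative - wealth_deriv y t) (at y)"
    using dual_point[OF x t] t y by (intro DERIV_minus wealth_has_derivative) auto
  then have "deriv (\<lambda>z. dual_value_y r \<delta> \<theta> V1 V2 z t) y = - wealth_deriv y t"
    unfolding wealth_def by (intro DERIV_imp_deriv) simp
  then show ?thesis unfolding optimal_amount_def by (simp add: Let_def y[symmetric] mult.assoc)
qed

definition limits_at_scale :: "(real \<Rightarrow> real) \<Rightarrow> bool" where
  "limits_at_scale S \<longleftrightarrow>
    (\<forall>\<sigma>. converges_at_scale S (optimal_amount r \<delta> \<theta> \<sigma> V1 V2) (\<lambda>x. \<theta> / \<sigma> * (1 - min q1 q2) * x)) \<and>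
    (\<forall>qhat qtilde L. qhat < 0 \<and> qtilde < qhat \<and>
       (\<forall>y\<ge>1. \<bar>deriv V2 y + y powr (qhat - 1)\<bar> \<le> L * y powr (qtilde - 1)) \<longrightarrow>
       converges_at_scale S
         (\<lambda>x t. rate_fun r \<delta> \<theta> q1 q2 t powr ((qhat - 1) / (q2 - 1)) * optimal_consumption r \<delta> \<theta> V1 V2 x t)
         (\<lambda>x. x powr ((qhat - 1) / (min q1 q2 - 1))))"

text \<open>Here G is the coefficient of the dominant power and g that of the other. The balance
  shows that u = \<open>y powr (m - 1) * G t\<close> tends to x. Applying -y d/dy multiplies u by 1
  - m, which gives the amount. For consumption, \<open>G powr k' * y powr (qhat - 1)\<close> equals
  \<open>u powr k'\<close> with k' = (qhat - 1)/(m - 1), and \<open>rate\<close> identifies the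
  power of G with that of R.\<close>

lemma limits_at_scaleI:
  fixes S G g :: "real \<Rightarrow> real" and m M \<gamma> \<Gamma> \<kappa> \<kappa>' :: real
  assumes S: "\<And>t. 1 \<le> t \<Longrightarrow> 1 \<le> S t"
    and m: "m = min q1 q2" and M: "M < 1" and \<gamma>: "0 < \<gamma>" and \<Gamma>: "0 \<le> \<Gamma>" and \<kappa>: "0 < \<kappa>"
    and gap: "\<kappa>' / (1 - M) < \<kappa> / (1 - m)"
    and G: "\<And>t. 1 \<le> t \<Longrightarrow> \<gamma> * S t powr \<kappa> \<le> G t"
    and g: "\<And>t. 1 \<le> t \<Longrightarrow> 0 \<le> g t" "\<And>t. 1 \<le> t \<Longrightarrow> g t \<le> \<Gamma> * S t powr \<kappa>'"
    and main: "\<And>y t. 0 < y \<Longrightarrow> 1 \<le> t \<Longrightarrow>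
      y powr (q1 - 1) * exp (\<Lambda> q1 * t) + y powr (q2 - 1) * exp_quot (\<Lambda> q2) t =
      y powr (m - 1) * G t + y powr (M - 1) * g t"
    and main_deriv: "\<And>y t. 0 < y \<Longrightarrow> 1 \<le> t \<Longrightarrow>
      (q1 - 1) * y powr (q1 - 1) * exp (\<Lambda> q1 * t) + (q2 - 1) * y powr (q2 - 1) * exp_quot (\<Lambda> q2) t =
      (m - 1) * (y powr (m - 1) * G t) + (M - 1) * (y powr (M - 1) * g t)"
    and rate: "\<And>e t. 1 \<le> t \<Longrightarrow> rate_fun r \<delta> \<theta> q1 q2 t powr (e / (q2 - 1)) = G t powr (e / (m - 1))"
  shows "limits_at_scale S"
proof -
  have mb: "m < b" and m1: "m < 1" using m D1.q D1.b by auto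
  define k where "k = \<kappa> / (1 - m)"
  have k: "0 < k" using \<kappa> m1 by (simp add: k_def)
  define E where "E = err_const"
  have E: "0 \<le> E" using err_const_nonneg by (simp add: E_def)
  obtain c d D where c: "0 < c" and d: "\<And>x. 0 < x \<Longrightarrow> 0 < d x" "\<And>x. d x \<le> 1"
    and balance: "\<And>x y S G g e. 0 < x \<Longrightarrow> 0 < y \<Longrightarrow> 1 \<le> S \<Longrightarrow> \<gamma> * S powr \<kappa> \<le> G \<Longrightarrow> 0 \<le> g \<Longrightarrow> g \<le> \<Gamma> * S powr \<kappa>' \<Longrightarrow>
      \<bar>e\<bar> \<le> E * y powr (b - 1) \<Longrightarrow> y powr (m - 1) * G + y powr (M - 1) * g + e = x \<Longrightarrow>
      d x * S powr k \<le> y \<and> y powr (b - 1) \<le> D x * S powr (- c) \<and> y powr (M - 1) * g \<le> D x * S powr (- c)"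
    unfolding k_def by (rule dominant_balance[OF mb M D1.b(2) \<gamma> \<Gamma> E \<kappa> gap]) blast
  define Y where "Y x t = dual_point r \<delta> \<theta> V1 V2 x t" for x t
  define u where "u x t = Y x t powr (m - 1) * G t" for x t
  have Y: "0 < Y x t" "d x * S t powr k \<le> Y x t"
      "Y x t powr (b - 1) \<le> D x * S t powr (- c)"
      "Y x t powr (M - 1) * g t \<le> D x * S t powr (- c)"
      "u x t + Y x t powr (M - 1) * g t + err (Y x t) t = x"
    if "0 < x" "1 \<le> t" for x t
  proof -
    show pos: "0 < Y x t" unfolding Y_def using dual_point[OF that] by simp
    have "wealth (Y x t) t = x" unfolding Y_def using dual_point[OF that] by simp
    then show eq: "u x t + Y x t powr (M - 1) * g t + err (Y x t) t = x"
      using that by (simp add: wealth_eq[OF pos] main[OF pos] u_def)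
    have "\<bar>err (Y x t) t\<bar> \<le> E * Y x t powr (b - 1)" unfolding E_def by (rule err_bound[OF that(2)])
    from balance[OF that(1) pos S[OF that(2)] G[OF that(2)] g[OF that(2)] this eq[unfolded u_def]]
    show "d x * S t powr k \<le> Y x t" "Y x t powr (b - 1) \<le> D x * S t powr (- c)"
      "Y x t powr (M - 1) * g t \<le> D x * S t powr (- c)" by auto
  qed
  have errE: "\<bar>err (Y x t) t\<bar> \<le> E * (D x * S t powr (- c))"
    and errdE: "\<bar>Y x t * err_deriv (Y x t) t\<bar> \<le> E * (D x * S t powr (- c))"
    and gpos: "0 \<le> Y x t powr (M - 1) * g t" if "0 < x" "1 \<le> t" for x t
  proof -
    note le = mult_left_mono[OF Y(3)[OF that] E]
    show "\<bar>err (Y x t) t\<bar> \<le> E * (D x * S t powr (- c))"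
      using err_bound[OF that(2), of "Y x t", folded E_def] le by (rule order_trans)
    show "\<bar>Y x t * err_deriv (Y x t) t\<bar> \<le> E * (D x * S t powr (- c))"
      using err_deriv_bound[OF Y(1)[OF that] that(2), folded E_def] le by (rule order_trans)
    show "0 \<le> Y x t powr (M - 1) * g t" using g(1)[OF that(2)] by simp
  qed
  have amount: "converges_at_scale S (optimal_amount r \<delta> \<theta> \<sigma> V1 V2) (\<lambda>x. \<theta> / \<sigma> * (1 - m) * x)" for \<sigma>
    unfolding converges_at_scale_def
  proof (intro exI[of _ c] conjI c exI[of _ "\<lambda>x. \<bar>\<theta> / \<sigma>\<bar> * ((1 - m) * (1 + E) + (1 - M) + E) * D x"] allI impI)
    fix x t :: real assume x: "0 < x" and t: "1 \<le> t"
    define y where "y = Y x t"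
    define Q where "Q = y powr (M - 1) * g t"
    define P where "P = D x * S t powr (- c)"
    have y: "0 < y" using Y(1)[OF x t] by (simp add: y_def)
    have Q: "0 \<le> Q" "Q \<le> P" using Y(4)[OF x t] gpos[OF x t] by (simp_all add: Q_def y_def P_def)
    have e: "\<bar>err y t\<bar> \<le> E * P" "\<bar>y * err_deriv y t\<bar> \<le> E * P"
      using errE[OF x t] errdE[OF x t] by (simp_all add: y_def P_def)
    \<comment> \<open>Eliminating u in favour of x leaves only the subdominant term and the errors,
      all of order \<open>P\<close>.\<close>
    have ux: "u x t = x - Q - err y t" using Y(5)[OF x t] by (simp add: Q_def y_def)
    have "y * wealth_deriv y t = (m - 1) * u x t + (M - 1) * Q + y * err_deriv y t"
    proof -
      have "y * (z / y + w) = z + y * w" for z w using y by (simp add: distrib_left)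
      then show ?thesis
        unfolding wealth_deriv_def main_deriv[OF y t] by (simp add: u_def Q_def y_def)
    qed
    then have "- (y * wealth_deriv y t) - (1 - m) * x = - ((1 - m) * (Q + err y t)) + (1 - M) * Q - y * err_deriv y t"
      by (simp add: ux algebra_simps)
    also have "\<bar>\<dots>\<bar> \<le> (1 - m) * (P + E * P) + (1 - M) * P + E * P"
    proof -
      have "\<bar>Q + err y t\<bar> \<le> P + E * P" using Q e by linarith
      then have "\<bar>(1 - m) * (Q + err y t)\<bar> \<le> (1 - m) * (P + E * P)"
        using m1 by (simp add: abs_mult mult_left_mono)
      moreover have "\<bar>(1 - M) * Q\<bar> \<le> (1 - M) * P" using Q M by (simp add: abs_mult mult_left_mono)
      ultimately show ?thesis using e(2) by linarith
    qed
    finally have bd: "\<bar>- (y * wealth_deriv y t) - (1 - m) * x\<bar> \<le> ((1 - m) * (1 + E) + (1 - M) + E) * P"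
      by (simp add: algebra_simps)
    have "optimal_amount r \<delta> \<theta> \<sigma> V1 V2 x t - \<theta> / \<sigma> * (1 - m) * x
        = \<theta> / \<sigma> * (- (y * wealth_deriv y t) - (1 - m) * x)"
      unfolding optimal_amount_eq[OF x t y_def[unfolded Y_def]] mult.assoc[of "\<theta> / \<sigma>" "1 - m" x]
      by (rule right_diff_distrib[symmetric])
    then have "\<bar>optimal_amount r \<delta> \<theta> \<sigma> V1 V2 x t - \<theta> / \<sigma> * (1 - m) * x\<bar>
        = \<bar>\<theta> / \<sigma>\<bar> * \<bar>- (y * wealth_deriv y t) - (1 - m) * x\<bar>"
      by (simp only: abs_mult)
    also have "\<dots> \<le> \<bar>\<theta> / \<sigma>\<bar> * (((1 - m) * (1 + E) + (1 - M) + E) * P)"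
      using bd by (intro mult_left_mono) auto
    finally show "\<bar>optimal_amount r \<delta> \<theta> \<sigma> V1 V2 x t - \<theta> / \<sigma> * (1 - m) * x\<bar>
        \<le> \<bar>\<theta> / \<sigma>\<bar> * ((1 - m) * (1 + E) + (1 - M) + E) * D x * S t powr (- c)"
      by (simp only: P_def mult.assoc)
  qed
  have consumption: "converges_at_scale S
      (\<lambda>x t. rate_fun r \<delta> \<theta> q1 q2 t powr ((qhat - 1) / (q2 - 1)) * optimal_consumption r \<delta> \<theta> V1 V2 x t)
      (\<lambda>x. x powr ((qhat - 1) / (m - 1)))"
    if qhat: "qhat < 0" and qtilde: "qtilde < qhat"
      and tail: "\<And>y. 1 \<le> y \<Longrightarrow> \<bar>deriv V2 y + y powr (qhat - 1)\<bar> \<le> L * y powr (qtilde - 1)"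
    for qhat qtilde L
  proof -
    define k' where "k' = (qhat - 1) / (m - 1)"
    have k': "0 < k'" using qhat m1 by (simp add: k'_def zero_less_divide_iff)
    have mk: "(m - 1) * k' = qhat - 1" using m1 by (simp add: k'_def)
    \<comment> \<open>A time-independent bound for u, needed for the Lipschitz estimate of the power
      k'; it uses that S powr (-c) is at most 1.\<close>
    define B where "B x = x + (1 + E) * D x" for x
    \<comment> \<open>Extends the tail estimate from y >= 1 to y >= \<open>d x\<close>: on the gap
      both terms are at most their values at \<open>d x\<close>, and
      \<open>y powr (qtilde - 1)\<close> is at least 1.\<close>
    define L' where "L' x = \<bar>L\<bar> + \<bar>deriv V2 (d x)\<bar> + d x powr (qhat - 1)" for x
    \<comment> \<open>The second rate comes from \<open>y powr (qtilde - qhat)\<close>, the relative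
      error of V2', with y growing at least like \<open>S powr k\<close>.\<close>
    define c' where "c' = min c (k * (qhat - qtilde))"
    have c': "0 < c'" using c k qtilde by (simp add: c'_def)
    define F where "F x = (k' * B x powr (k' - 1) + x powr (k' - 1)) * ((1 + E) * D x)
      + B x powr k' * (L' x * d x powr (qtilde - qhat))" for x
    have "\<bar>G t powr k' * - deriv V2 (Y x t) - x powr k'\<bar> \<le> F x * S t powr (- c')"
      if x: "0 < x" and t: "1 \<le> t" for x t
    proof -
      define y where "y = Y x t"
      have y: "0 < y" using Y(1)[OF x t] by (simp add: y_def)
      have St: "1 \<le> S t" by (rule S[OF t])
      have SG: "S t powr e \<le> S t powr (- c')" if "e \<le> - c'" for e using St that by (intro powr_mono) auto
      have dx: "0 < d x" "d x \<le> 1" using d x by auto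
      \<comment> \<open>The balance does not assert positivity of D; it follows because D bounds a
        positive power of y.\<close>
      have Dx: "0 < D x"
      proof -
        have "0 < y powr (b - 1)" using y by simp
        then have "0 < D x * S t powr (- c)" using Y(3)[OF x t] unfolding y_def by linarith
        then show ?thesis using St by (simp add: zero_less_mult_iff)
      qed
      have "1 \<le> S t powr k" using St k by (intro ge_one_powr_ge_zero) auto
      then have "d x * 1 \<le> d x * S t powr k" using dx by (intro mult_left_mono) auto
      then have dy: "d x \<le> y" using Y(2)[OF x t] by (simp add: y_def)
      have G0: "0 < G t" using \<gamma> St by (intro less_le_trans[OF _ G[OF t]]) auto
      have u0: "0 < u x t" using G0 y by (simp add: u_def y_def)
      have ux: "\<bar>u x t - x\<bar> \<le> (1 + E) * D x * S t powr (- c)"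
      proof -
        have "\<bar>u x t - x\<bar> \<le> D x * S t powr (- c) + E * (D x * S t powr (- c))"
          using Y(4,5)[OF x t] errE[OF x t] gpos[OF x t] by linarith
        then show ?thesis by (simp add: algebra_simps)
      qed
      have uB: "u x t \<le> B x"
      proof -
        have "S t powr (- c) \<le> S t powr 0" using St c by (intro powr_mono) auto
        then have "(1 + E) * D x * S t powr (- c) \<le> (1 + E) * D x * 1"
          using E Dx St by (intro mult_left_mono) auto
        then show ?thesis using ux by (simp add: B_def)
      qed
      have xB: "x \<le> B x" using E Dx by (simp add: B_def)
      have "\<bar>u x t powr k' - x powr k'\<bar> \<le> (k' * B x powr (k' - 1) + x powr (k' - 1)) * \<bar>u x t - x\<bar>"
        by (rule abs_powr_diff_le[OF u0 uB x xB k'])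
      also have "\<dots> \<le> (k' * B x powr (k' - 1) + x powr (k' - 1)) * ((1 + E) * D x * S t powr (- c'))"
      proof (intro mult_left_mono)
        have "(1 + E) * D x * S t powr (- c) \<le> (1 + E) * D x * S t powr (- c')"
          using E Dx by (intro mult_left_mono SG) (auto simp: c'_def)
        with ux show "\<bar>u x t - x\<bar> \<le> (1 + E) * D x * S t powr (- c')" by linarith
      qed (use k' in auto)
      finally have 1: "\<bar>u x t powr k' - x powr k'\<bar> \<le> (k' * B x powr (k' - 1) + x powr (k' - 1)) * ((1 + E) * D x * S t powr (- c'))" .
      have near: "\<bar>deriv V2 y + y powr (qhat - 1)\<bar> \<le> L' x * y powr (qtilde - 1)"
      proof (cases "1 \<le> y")
        case True
        have "L * y powr (qtilde - 1) \<le> L' x * y powr (qtilde - 1)"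
        proof (rule mult_right_mono)
          show "L \<le> L' x" unfolding L'_def using abs_ge_self[of L] powr_ge_zero[of "d x" "qhat - 1"] by linarith
        qed simp
        then show ?thesis using tail[OF True] by linarith
      next
        case False
        have "\<bar>deriv V2 y\<bar> \<le> \<bar>deriv V2 (d x)\<bar>" using D2.antimono[OF dx(1) dy] .
        moreover have "y powr (qhat - 1) \<le> d x powr (qhat - 1)" using dy dx qhat by (intro powr_mono2') auto
        ultimately have "\<bar>deriv V2 y\<bar> + \<bar>y powr (qhat - 1)\<bar> \<le> L' x * 1"
          by (simp add: L'_def add_increasing add_mono add.assoc)
        then have "\<bar>deriv V2 y + y powr (qhat - 1)\<bar> \<le> L' x * 1"
          by (rule order_trans[OF abs_triangle_ineq])
        also have "\<dots> \<le> L' x * y powr (qtilde - 1)"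
        proof (rule mult_left_mono)
          have "y powr 0 \<le> y powr (qtilde - 1)" using False y qtilde qhat by (intro powr_mono') auto
          then show "1 \<le> y powr (qtilde - 1)" using y by simp
        qed (simp add: L'_def)
        finally show ?thesis .
      qed
      \<comment> \<open>The case e = qhat gives exactly \<open>u powr k'\<close>, the case e =
        qtilde the size of the error relative to it.\<close>
      have uk: "G t powr k' * y powr (e - 1) = u x t powr k' * y powr (e - qhat)" for e
      proof -
        have "u x t powr k' = y powr (qhat - 1) * G t powr k'"
          using y G0 by (simp add: u_def y_def powr_mult powr_powr mk)
        then show ?thesis by (simp add: powr_add[symmetric])
      qed
      have "\<bar>G t powr k' * - deriv V2 y - u x t powr k'\<bar> = G t powr k' * \<bar>deriv V2 y + y powr (qhat - 1)\<bar>"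
      proof -
        have "u x t powr k' = G t powr k' * y powr (qhat - 1)" using uk[of qhat] y by simp
        then have "G t powr k' * - deriv V2 y - u x t powr k' = - (G t powr k' * (deriv V2 y + y powr (qhat - 1)))"
          by (simp add: distrib_left)
        then show ?thesis by (simp add: abs_mult)
      qed
      also have "\<dots> \<le> G t powr k' * (L' x * y powr (qtilde - 1))" using near by (intro mult_left_mono) auto
      also have "\<dots> = u x t powr k' * (L' x * y powr (qtilde - qhat))" using uk[of qtilde] by (simp add: mult_ac)
      also have "\<dots> \<le> B x powr k' * (L' x * (d x powr (qtilde - qhat) * S t powr (- c')))"
      proof (intro mult_mono)
        show "u x t powr k' \<le> B x powr k'" using u0 uB k' by (intro powr_mono2) auto
        have "y powr (qtilde - qhat) \<le> (d x * S t powr k) powr (qtilde - qhat)"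
          using Y(2)[OF x t] dx St qtilde by (intro powr_mono2') (auto simp: y_def)
        also have "\<dots> = d x powr (qtilde - qhat) * S t powr (k * (qtilde - qhat))"
          using dx St by (simp add: powr_mult powr_powr)
        also have "\<dots> \<le> d x powr (qtilde - qhat) * S t powr (- c')"
          by (intro mult_left_mono SG) (auto simp: c'_def algebra_simps min_def)
        finally show "y powr (qtilde - qhat) \<le> d x powr (qtilde - qhat) * S t powr (- c')" .
      qed (auto simp: L'_def)
      finally have 2: "\<bar>G t powr k' * - deriv V2 y - u x t powr k'\<bar>
        \<le> B x powr k' * (L' x * (d x powr (qtilde - qhat) * S t powr (- c')))" .
      have "F x * S t powr (- c') = (k' * B x powr (k' - 1) + x powr (k' - 1)) * ((1 + E) * D x * S t powr (- c'))
        + B x powr k' * (L' x * (d x powr (qtilde - qhat) * S t powr (- c')))"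
        unfolding F_def distrib_right[of _ _ "S t powr (- c')"] by (simp only: mult.assoc)
      then show ?thesis using 1 2 unfolding y_def by linarith
    qed
    then show ?thesis
      unfolding converges_at_scale_def using c'
      by (intro exI[of _ c'] conjI exI[of _ F]) (auto simp: rate k'_def[symmetric] optimal_consumption_def Y_def)
  qed
  show ?thesis
    unfolding limits_at_scale_def m[symmetric] using amount consumption by blast
qed


text \<open>In each case the smaller exponent lies below q*, so its \<open>lambda\<close> is
  positive and the dominant coefficient grows exponentially.\<close>

lemma limits_exponential:
  assumes q: "q1 < qstar r \<delta> \<theta> \<or> q2 < qstar r \<delta> \<theta>"
  shows "limits_at_scale exp"
proof -
  consider "q1 = q2" | "q1 < q2" | "q2 < q1" by linarith
  then show ?thesis
  proof cases
    case 1
    then have pos: "0 < \<Lambda> q1" using q by (auto intro: lambda_pos)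
    show ?thesis
    proof (rule limits_at_scaleI[where G = "\<lambda>t. exp (\<Lambda> q1 * t) + exp_quot (\<Lambda> q2) t" and g = "\<lambda>_. 0"
          and m = q1 and M = q1 and \<gamma> = 1 and \<Gamma> = 0 and \<kappa> = "\<Lambda> q1" and \<kappa>' = 0])
      show "1 * exp t powr \<Lambda> q1 \<le> exp (\<Lambda> q1 * t) + exp_quot (\<Lambda> q2) t" if "1 \<le> t" for t
        using exp_quot_nonneg[of t "\<Lambda> q2"] that by (simp add: exp_powr_real mult.commute)
    qed (use 1 pos q1 in \<open>auto simp: rate_fun_def Let_def algebra_simps\<close>)
  next
    case 2
    then have pos: "0 < \<Lambda> q1" using q by (auto intro: lambda_pos)
    \<comment> \<open>The bound on \<open>exp_quot\<close> carries a factor t, so \<kappa>' must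
      exceed max(\<open>\<Lambda> q2\<close>, 0) strictly and still respect the gap; the midpoint
      \<mu> leaves room on both sides. The slack \<epsilon> absorbs t through t <= exp(\<epsilon>
      t)/\<epsilon>.\<close>
    define \<mu> where "\<mu> = (max 0 (\<Lambda> q2 / (1 - q2)) + \<Lambda> q1 / (1 - q1)) / 2"
    have mid: "u < (u + v) / 2 \<and> (u + v) / 2 < v" if "u < v" for u v :: real using that by simp
    have "max 0 (\<Lambda> q2 / (1 - q2)) < \<Lambda> q1 / (1 - q1)"
      using lambda_slope[OF 2 q2] pos q1 by simp
    then have \<mu>: "max 0 (\<Lambda> q2 / (1 - q2)) < \<mu>" "\<mu> < \<Lambda> q1 / (1 - q1)"
      unfolding \<mu>_def using mid by blast+
    define \<epsilon> where "\<epsilon> = \<mu> * (1 - q2) - max (\<Lambda> q2) 0"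
    have \<epsilon>: "0 < \<epsilon>"
    proof -
      have "0 < \<mu> * (1 - q2)" using \<mu>(1) q2 by simp
      moreover have "\<Lambda> q2 < \<mu> * (1 - q2)" using \<mu>(1) q2 by (simp add: pos_divide_less_eq)
      ultimately show ?thesis by (simp add: \<epsilon>_def)
    qed
    show ?thesis
    proof (rule limits_at_scaleI[where G = "\<lambda>t. exp (\<Lambda> q1 * t)" and g = "exp_quot (\<Lambda> q2)"
          and m = q1 and M = q2 and \<gamma> = 1 and \<Gamma> = "1 / \<epsilon>" and \<kappa> = "\<Lambda> q1" and \<kappa>' = "\<mu> * (1 - q2)"])
      show "\<mu> * (1 - q2) / (1 - q2) < \<Lambda> q1 / (1 - q1)" using \<mu>(2) q2 by simp
      show "1 * exp t powr \<Lambda> q1 \<le> exp (\<Lambda> q1 * t)" for t by (simp add: exp_powr_real mult.commute)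
      show "exp_quot (\<Lambda> q2) t \<le> 1 / \<epsilon> * exp t powr (\<mu> * (1 - q2))" if t: "1 \<le> t" for t
      proof -
        have "\<epsilon> * t \<le> exp (\<epsilon> * t)" using exp_ge_add_one_self[of "\<epsilon> * t"] by linarith
        then have "t \<le> 1 / \<epsilon> * exp (\<epsilon> * t)" using \<epsilon> by (simp add: field_simps)
        then have "t * exp (max (\<Lambda> q2) 0 * t) \<le> 1 / \<epsilon> * exp (\<epsilon> * t) * exp (max (\<Lambda> q2) 0 * t)"
          by (rule mult_right_mono) simp
        also have "\<dots> = 1 / \<epsilon> * exp (\<mu> * (1 - q2) * t)"
          unfolding mult.assoc mult_exp_exp by (simp add: \<epsilon>_def algebra_simps)
        finally show ?thesis
          using exp_quot_le[of t "\<Lambda> q2"] t by (simp add: exp_powr_real mult.commute)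
      qed
      \<comment> \<open>The exponent (q2 - 1)/(q1 - 1) in R converts the power 1/(q2 - 1) into the
        power 1/(q1 - 1) of G.\<close>
      show "rate_fun r \<delta> \<theta> q1 q2 t powr (e / (q2 - 1)) = exp (\<Lambda> q1 * t) powr (e / (q1 - 1))" for e t
        using 2 q2 by (simp add: rate_fun_def Let_def exp_powr_real)
    qed (use 2 pos q1 q2 \<epsilon> in \<open>auto intro: exp_quot_nonneg\<close>)
  next
    case 3
    then have pos: "0 < \<Lambda> q2" using q by (auto intro: lambda_pos)
    show ?thesis
    proof (rule limits_at_scaleI[where G = "exp_quot (\<Lambda> q2)" and g = "\<lambda>t. exp (\<Lambda> q1 * t)"
          and m = q2 and M = q1 and \<gamma> = "(1 - exp (- \<Lambda> q2)) / \<Lambda> q2" and \<Gamma> = 1 and \<kappa> = "\<Lambda> q2" and \<kappa>' = "\<Lambda> q1"])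
      show "\<Lambda> q1 / (1 - q1) < \<Lambda> q2 / (1 - q2)" by (rule lambda_slope[OF 3 q1])
      show "(1 - exp (- \<Lambda> q2)) / \<Lambda> q2 * exp t powr \<Lambda> q2 \<le> exp_quot (\<Lambda> q2) t" if "1 \<le> t" for t
        using exp_quot_ge[OF pos that] by (simp add: exp_powr_real mult.commute)
    qed (use 3 pos q1 in \<open>auto simp: rate_fun_def Let_def exp_powr_real mult.commute algebra_simps\<close>)
  qed
qed

text \<open>At q2 = q* \<open>lambda\<close> vanishes and \<open>exp_quot\<close> is t itself, so G
  grows only linearly. If q1 > q2, the other coefficient is at most 1, and the linear growth of G
  alone provides the gap.\<close>

lemma limits_polynomial:
  assumes q: "qstar r \<delta> \<theta> \<le> q1" "q2 = qstar r \<delta> \<theta>"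
  shows "limits_at_scale (\<lambda>t. t)"
proof -
  have l2: "\<Lambda> q2 = 0" using lambda_qstar q by simp
  show ?thesis
  proof (cases "q1 = q2")
    case True
    show ?thesis
      by (rule limits_at_scaleI[where G = "\<lambda>t. 1 + t" and g = "\<lambda>_. 0"
            and m = q1 and M = q1 and \<gamma> = 1 and \<Gamma> = 0 and \<kappa> = 1 and \<kappa>' = 0])
        (use True l2 q1 in \<open>auto simp: rate_fun_def Let_def exp_quot_def algebra_simps\<close>)
  next
    case False
    then have less: "q2 < q1" using q by simp
    show ?thesis
    proof (rule limits_at_scaleI[where G = "\<lambda>t. t" and g = "\<lambda>t. exp (\<Lambda> q1 * t)"
          and m = q2 and M = q1 and \<gamma> = 1 and \<Gamma> = 1 and \<kappa> = 1 and \<kappa>' = 0])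
      show "exp (\<Lambda> q1 * t) \<le> 1 * t powr 0" if "1 \<le> t" for t
        using lambda_nonpos[OF q(1) q1] that by (simp add: mult_nonpos_nonneg)
    qed (use less l2 q1 q2 in \<open>auto simp: rate_fun_def Let_def exp_quot_def algebra_simps\<close>)
  qed
qed

end

section \<open>From utilities to the asymptotic hypotheses, and the conclusion\<close>

lemma dual_asymptotics_dual_fun:
  assumes "0 < r" "0 < \<delta>" "\<theta> \<noteq> 0"
    and U: "utility U" and C1: "dual_fun U C1_differentiable_on {0<..}"
    and q: "q < b" and b: "0 < b" "b < 1" and L: "0 < L"
    and near: "\<forall>y. 0 < y \<and> y \<le> 1 \<longrightarrow> \<bar>deriv (dual_fun U) y + y powr (q - 1)\<bar> \<le> L * y powr (b - 1)"
  obtains K where "dual_asymptotics r \<delta> \<theta> (dual_fun U) q b K"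
proof -
  obtain K where K: "\<And>y. 0 < y \<Longrightarrow> \<bar>\<bar>deriv (dual_fun U) y\<bar> - y powr (q - 1)\<bar> \<le> K * y powr (b - 1)"
    using deriv_dual_fun_near_power[OF U C1 q b(1) L] near by blast
  have "dual_asymptotics r \<delta> \<theta> (dual_fun U) q b K"
  proof
    show "\<bar>deriv (dual_fun U) y\<bar> \<le> \<bar>deriv (dual_fun U) x\<bar>" if "0 < x" "x \<le> y" for x y
      using deriv_dual_fun_mono[OF U C1 that] deriv_dual_fun_nonpos[OF U C1, of y] that by simp
  qed (use assms K C1_differentiable_on_deriv(2)[OF C1] in auto)
  then show ?thesis by (rule that)
qed

theorem theorem2p5:
  fixes r \<delta> \<mu> \<sigma> \<theta> q1 q2 qbar L :: real
    and U1 U2 V1 V2 :: "real \<Rightarrow> real"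
  assumes "r > 0" and "\<delta> > 0" and "\<mu> > 0" and "\<sigma> > 0"
    and "\<theta> = (\<mu> - r) / \<sigma>" and "\<theta> \<noteq> 0"
    and "utility U1" and "utility U2"
    and "V1 = dual_fun U1" and "V2 = dual_fun U2"
    and "q1 < 1" and "q2 < 1"
    and "V1 C1_differentiable_on {0<..}" and "V2 C1_differentiable_on {0<..}"
    and "max (max q1 q2) 0 < qbar" and "qbar < 1" and "L > 0"
    and "\<forall>y. 0 < y \<and> y \<le> 1 \<longrightarrow> \<bar>deriv V1 y + y powr (q1 - 1)\<bar> \<le> L * y powr (qbar - 1)"
    and "\<forall>y. 0 < y \<and> y \<le> 1 \<longrightarrow> \<bar>deriv V2 y + y powr (q2 - 1)\<bar> \<le> L * y powr (qbar - 1)"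
  shows
    "(q1 < qstar r \<delta> \<theta> \<or> q2 < qstar r \<delta> \<theta> \<longrightarrow>
        converges_exponentially (optimal_amount r \<delta> \<theta> \<sigma> V1 V2)
          (\<lambda>x. \<theta> / \<sigma> * (1 - min q1 q2) * x)) \<and>
     (q1 \<ge> qstar r \<delta> \<theta> \<and> q2 = qstar r \<delta> \<theta> \<longrightarrow>
        converges_polynomially (optimal_amount r \<delta> \<theta> \<sigma> V1 V2)
          (\<lambda>x. \<theta> / \<sigma> * (1 - min q1 q2) * x)) \<and>
     (\<forall>qhat qtilde. qhat < 0 \<and> qtilde < min qhat q2 \<and>
        (\<forall>y\<ge>1. \<bar>deriv V2 y + y powr (qhat - 1)\<bar> \<le> L * y powr (qtilde - 1)) \<longrightarrow>
        (q1 < qstar r \<delta> \<theta> \<or> q2 < qstar r \<delta> \<theta> \<longrightarrow>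
           converges_exponentially
             (\<lambda>x t. rate_fun r \<delta> \<theta> q1 q2 t powr ((qhat - 1) / (q2 - 1))
                    * optimal_consumption r \<delta> \<theta> V1 V2 x t)
             (\<lambda>x. x powr ((qhat - 1) / (min q1 q2 - 1)))) \<and>
        (q1 \<ge> qstar r \<delta> \<theta> \<and> q2 = qstar r \<delta> \<theta> \<longrightarrow>
           converges_polynomially
             (\<lambda>x t. rate_fun r \<delta> \<theta> q1 q2 t powr ((qhat - 1) / (q2 - 1))
                    * optimal_consumption r \<delta> \<theta> V1 V2 x t)
             (\<lambda>x. x powr ((qhat - 1) / (min q1 q2 - 1)))))"
proof -
  have qb: "q1 < qbar" "q2 < qbar" "0 < qbar" using assms by auto
  obtain K1 where K1: "dual_asymptotics r \<delta> \<theta> V1 q1 qbar K1"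
    using dual_asymptotics_dual_fun[OF \<open>r > 0\<close> \<open>\<delta> > 0\<close> \<open>\<theta> \<noteq> 0\<close> \<open>utility U1\<close> _ qb(1,3) \<open>qbar < 1\<close> \<open>L > 0\<close>] assms
    by metis
  obtain K2 where K2: "dual_asymptotics r \<delta> \<theta> V2 q2 qbar K2"
    using dual_asymptotics_dual_fun[OF \<open>r > 0\<close> \<open>\<delta> > 0\<close> \<open>\<theta> \<noteq> 0\<close> \<open>utility U2\<close> _ qb(2,3) \<open>qbar < 1\<close> \<open>L > 0\<close>] assms
    by metis
  interpret two_duals r \<delta> \<theta> V1 V2 q1 q2 qbar K1 K2
    using \<open>r > 0\<close> \<open>\<delta> > 0\<close> \<open>\<theta> \<noteq> 0\<close> K1 K2
    by (intro two_duals.intro two_duals_axioms.intro market.intro)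
  have exp: "converges_exponentially f g"
    if "q1 < qstar r \<delta> \<theta> \<or> q2 < qstar r \<delta> \<theta>" "limits_at_scale exp \<Longrightarrow> converges_at_scale exp f g" for f g
    using that limits_exponential by (blast intro: converges_at_scale_exp)
  have poly: "converges_polynomially f g"
    if "q1 \<ge> qstar r \<delta> \<theta> \<and> q2 = qstar r \<delta> \<theta>"
      "limits_at_scale (\<lambda>t. t) \<Longrightarrow> converges_at_scale (\<lambda>t. t) f g" for f g
    using that limits_polynomial by (blast intro: converges_at_scale_id)
  show ?thesis
  proof (intro conjI allI impI)
    fix qhat qtilde
    assume "qhat < 0 \<and> qtilde < min qhat q2 \<and>
      (\<forall>y\<ge>1. \<bar>deriv V2 y + y powr (qhat - 1)\<bar> \<le> L * y powr (qtilde - 1))"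
    then have tail: "qhat < 0 \<and> qtilde < qhat \<and>
      (\<forall>y\<ge>1. \<bar>deriv V2 y + y powr (qhat - 1)\<bar> \<le> L * y powr (qtilde - 1))" by simp
    have limit: "converges_at_scale S
      (\<lambda>x t. rate_fun r \<delta> \<theta> q1 q2 t powr ((qhat - 1) / (q2 - 1)) * optimal_consumption r \<delta> \<theta> V1 V2 x t)
      (\<lambda>x. x powr ((qhat - 1) / (min q1 q2 - 1)))" if "limits_at_scale S" for S
      using that[unfolded limits_at_scale_def] tail by blast
    show "converges_exponentially
      (\<lambda>x t. rate_fun r \<delta> \<theta> q1 q2 t powr ((qhat - 1) / (q2 - 1)) * optimal_consumption r \<delta> \<theta> V1 V2 x t)
      (\<lambda>x. x powr ((qhat - 1) / (min q1 q2 - 1)))" if "q1 < qstar r \<delta> \<theta> \<or> q2 < qstar r \<delta> \<theta>"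
      by (rule exp[OF that limit])
    show "converges_polynomially
      (\<lambda>x t. rate_fun r \<delta> \<theta> q1 q2 t powr ((qhat - 1) / (q2 - 1)) * optimal_consumption r \<delta> \<theta> V1 V2 x t)
      (\<lambda>x. x powr ((qhat - 1) / (min q1 q2 - 1)))" if "q1 \<ge> qstar r \<delta> \<theta> \<and> q2 = qstar r \<delta> \<theta>"
      by (rule poly[OF that limit])
  next
    have limit: "converges_at_scale S (optimal_amount r \<delta> \<theta> \<sigma> V1 V2) (\<lambda>x. \<theta> / \<sigma> * (1 - min q1 q2) * x)"
      if "limits_at_scale S" for S
      using that[unfolded limits_at_scale_def] by blast
    show "converges_exponentially (optimal_amount r \<delta> \<theta> \<sigma> V1 V2) (\<lambda>x. \<theta> / \<sigma> * (1 - min q1 q2) * x)"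
      if "q1 < qstar r \<delta> \<theta> \<or> q2 < qstar r \<delta> \<theta>"
      by (rule exp[OF that limit])
    show "converges_polynomially (optimal_amount r \<delta> \<theta> \<sigma> V1 V2) (\<lambda>x. \<theta> / \<sigma> * (1 - min q1 q2) * x)"
      if "q1 \<ge> qstar r \<delta> \<theta> \<and> q2 = qstar r \<delta> \<theta>"
      by (rule poly[OF that limit])
  qed
qed

end
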